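(* Let $K=k(\sqrt{D})$ be a real quadratic function field and let $n\ge 2$ be an integer. Then the ideal class group $H(D)$ of $K$ contains a cyclic subgroup of order $n$ if and only if there exists $Z\in R\setminus\mathbf{F}_q$ such that both of the following hold: (i) for some $c\in\mathbf{F}_q^\times$, the equation $X^2-DY^2=cZ^n$ has a solution $(X,Y)$ with $X,Y\in R$ relatively prime; (ii) for every $c'\in\mathbf{F}_q^\times$ and every integer $j$ with $1\le j$, $j\mid n$, $j\neq n$, the equation $X^2-DY^2=c'Z^j$ has no solution $(X,Y)$ with $X,Y\in R$ relatively prime.
   Context: $\mathbf{F}_q$ is the finite field with $q$ elements, $q$ odd; $R=\mathbf{F}_q[T]$ and $k=\mathbf{F}_q(T)$. A real quadratic function field is $K=k(\sqrt{D})$ with $D\in R$ a non-constant square-free polynomial of even degree whose leading coefficient is a square in $\mathbf{F}_q^\times$ (in particular, this holds for $D$ monic of positive even degree). $\mathcal{O}_K$ is the integral closure of $R$ in $K$, which equals $R+R\sqrt{D}$. $H(K)=H(D)$ denotes the ideal class group of $\mathcal{O}_K$, i.e. the group of fractional ideals of $\mathcal{O}_K$ modulo principal fractional ideals. *)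

theory Defs
  imports
    "HOL-Library.Cardinality"
    "HOL-Computational_Algebra.Computational_Algebra"
    "HOL-Algebra.Generated_Fields"
    "HOL-Algebra.Elementary_Groups"
    "HOL-Algebra.Algebraic_Closure_Type"
begin

text \<open>
  For a finite field \<^typ>\<open>'a\<close>, the ring $R$ is \<^typ>\<open>'a poly\<close>, the field $k$ is
  \<^typ>\<open>'a poly fract\<close>, and quadratic extensions of $k$ are taken inside the algebraic closure
  of $k$.
\<close>

definition real_quadratic :: "'a::field poly \<Rightarrow> bool" where
  "real_quadratic D \<longleftrightarrow>
     Polynomial.degree D > 0 \<and> even (Polynomial.degree D) \<and> squarefree D \<and>
     (\<exists>a. a \<noteq> 0 \<and> Polynomial.lead_coeff D = a\<^sup>2)"

definition emb :: "'a::field poly \<Rightarrow> 'a poly fract alg_closure" where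
  "emb p = to_ac (to_fract p)"

definition sqrt_elt :: "'a::field poly \<Rightarrow> 'a poly fract alg_closure" where
  "sqrt_elt D = (SOME s. s\<^sup>2 = emb D)"

lemma sqrt_elt_square: "(sqrt_elt D)\<^sup>2 = emb D"
proof -
  have "\<exists>s. s\<^sup>2 = emb D"
    using nth_root_exists[of 2 "emb D"] by auto
  then show ?thesis
    unfolding sqrt_elt_def by (rule someI_ex)
qed

text \<open>The two choices of the square root differ by sign and generate the same field.\<close>

definition quad_field :: "'a::field poly \<Rightarrow> 'a poly fract alg_closure set" where
  "quad_field D = generate_field ring_of_type_algebra (insert (sqrt_elt D) (range to_ac))"

definition quad_integers :: "'a::field poly \<Rightarrow> 'a poly fract alg_closure set" where
  "quad_integers D =
     {x \<in> quad_field D. \<exists>p :: 'a poly poly.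
        Polynomial.lead_coeff p = 1 \<and> poly (map_poly emb p) x = 0}"

definition fractional_ideal ::
    "'a::field poly \<Rightarrow> 'a poly fract alg_closure set \<Rightarrow> bool" where
  "fractional_ideal D I \<longleftrightarrow>
     I \<subseteq> quad_field D \<and> 0 \<in> I \<and> I \<noteq> {0} \<and>
     (\<forall>x\<in>I. \<forall>y\<in>I. x + y \<in> I) \<and>
     (\<forall>a\<in>quad_integers D. \<forall>x\<in>I. a * x \<in> I) \<and>
     (\<exists>d\<in>quad_integers D. d \<noteq> 0 \<and> (\<forall>x\<in>I. d * x \<in> quad_integers D))"

definition ideal_mult :: "'b::comm_ring_1 set \<Rightarrow> 'b set \<Rightarrow> 'b set" where
  "ideal_mult I J =
     {(\<Sum>i<m. f i * g i) | (m::nat) f g. \<forall>i<m. f i \<in> I \<and> g i \<in> J}"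

definition ideal_group :: "'a::field poly \<Rightarrow> 'a poly fract alg_closure set monoid" where
  "ideal_group D =
     \<lparr>carrier = {I. fractional_ideal D I}, monoid.mult = ideal_mult, one = quad_integers D\<rparr>"

definition principal_ideals :: "'a::field poly \<Rightarrow> 'a poly fract alg_closure set set" where
  "principal_ideals D = {(\<lambda>a. x * a) ` quad_integers D | x. x \<in> quad_field D \<and> x \<noteq> 0}"

definition class_group :: "'a::field poly \<Rightarrow> 'a poly fract alg_closure set set monoid" where
  "class_group D = ideal_group D Mod principal_ideals D"

definition has_cyclic_subgroup_of_order :: "('g, 'm) monoid_scheme \<Rightarrow> nat \<Rightarrow> bool" where
  "has_cyclic_subgroup_of_order G n \<longleftrightarrow>
     (\<exists>C. subgroup C G \<and> cyclic_group (G\<lparr>carrier := C\<rparr>) \<and> card C = n)"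

end

theory Submission
  imports Defs
begin

text \<open>
  Write \<open>s\<close> for the square root of \<open>D\<close>. Then \<open>\<O> = R + R s\<close>, and every ideal class contains an ideal
  \<open>I(m, b) = (m, b + s)\<close> with \<open>m\<close> dividing \<open>b\<^sup>2 - D\<close> and coprime to \<open>b\<close>. These ideals multiply by
  \<open>I(m\<^sub>1, b) I(m\<^sub>2, b) = I(m\<^sub>1 m\<^sub>2, b)\<close>, conjugation \<open>b \<mapsto> - b\<close> inverts the class, and \<open>I(m, t)\<close> is principal for
  some \<open>t\<close> exactly if \<open>x\<^sup>2 - D y\<^sup>2 = c m\<close> has a coprime solution.

  Given \<open>Z\<close>, a solution for \<open>Z\<^sup>n\<close> yields \<open>t\<close> with \<open>I(Z, t)\<^sup>n = I(Z\<^sup>n, t)\<close> principal, and a smaller order \<open>j\<close>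
  of the class would give a coprime solution for \<open>Z\<^sup>j\<close>.

  Conversely, let \<open>I(m, b)\<close> have order \<open>n\<close> in the (finite) class group. Condition (ii) concerns all
  square roots of \<open>D\<close> modulo \<open>Z\<^sup>j\<close>, not just one, so \<open>Z = m\<close> need not work. Instead \<open>n\<close> divides the
  least common multiple of the orders of the classes of \<open>I(p, b)\<close>, \<open>p\<close> a prime factor of \<open>m\<close>; hence it
  is a product of pairwise coprime numbers \<open>n\<^sub>p\<close> dividing these orders, and \<open>Z\<close> is the product of the
  powers \<open>p\<^sup>u\<close> for which \<open>I(p, b)\<^sup>u\<close> has order \<open>n\<^sub>p\<close>. Changing the sign of the root modulo a single prime
  inverts one of these classes of pairwise coprime order, which does not affect the order of the product.
\<close>

section \<open>Divisibility\<close>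

lemma euclid_gcd_exists:
  fixes a b :: "'r::euclidean_ring"
  shows "\<exists>g r t. g = r * a + t * b \<and> g dvd a \<and> g dvd b"
proof (induction "euclidean_size b" arbitrary: a b rule: less_induct)
  case less
  show ?case
  proof (cases "b = 0")
    case True
    then show ?thesis
      by (intro exI[of _ a] exI[of _ 1] exI[of _ 0]) auto
  next
    case False
    then have "euclidean_size (a mod b) < euclidean_size b"
      by (rule mod_size_less)
    from less[OF this] obtain g r t
      where g: "g = r * b + t * (a mod b)" "g dvd b" "g dvd a mod b" by blast
    have "a mod b = a - (a div b) * b"
      by (rule minus_div_mult_eq_mod [symmetric])
    then have "g = t * a + (r - t * (a div b)) * b"
      using g(1) by (simp only: left_diff_distrib right_diff_distrib distrib_left mult.assoc) (simp add: algebra_simps)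
    moreover have "g dvd a"
      using g(2,3) by (simp add: dvd_mod_iff)
    ultimately show ?thesis using g(2) by blast
  qed
qed

lemma coprime_iff_bezout:
  fixes a b :: "'r::euclidean_ring"
  shows "coprime a b \<longleftrightarrow> (\<exists>r t. r * a + t * b = 1)"
proof
  assume ab: "coprime a b"
  obtain g r t where g: "g = r * a + t * b" "g dvd a" "g dvd b"
    using euclid_gcd_exists by blast
  have "is_unit g" using ab g(2,3) by (rule coprime_common_divisor)
  then obtain h where "1 = g * h" by (elim dvdE)
  then have "(h * r) * a + (h * t) * b = 1"
    using g(1) by (simp add: algebra_simps)
  then show "\<exists>r t. r * a + t * b = 1" by blast
next
  assume "\<exists>r t. r * a + t * b = 1"
  then show "coprime a b"
    by (metis coprime_def dvd_add dvd_mult)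
qed

lemma euclid_coprime_mult:
  fixes a b c :: "'r::euclidean_ring"
  assumes "coprime a c" "coprime b c"
  shows "coprime (a * b) c"
proof -
  obtain r t r' t' where "r * a + t * c = 1" "r' * b + t' * c = 1"
    using assms unfolding coprime_iff_bezout by blast
  then have "(r * a + t * c) * (r' * b + t' * c) = 1" by simp
  then have "(r * r') * (a * b) + (r * a * t' + t * r' * b + t * c * t') * c = 1"
    by (simp add: algebra_simps)
  then show ?thesis unfolding coprime_iff_bezout by blast
qed

lemma euclid_coprime_power:
  fixes a c :: "'r::euclidean_ring"
  assumes "coprime a c"
  shows "coprime (a ^ k) c"
  using assms by (induction k) (auto intro: euclid_coprime_mult)

lemma euclid_coprime_dvd_mult:
  fixes a b c :: "'r::euclidean_ring"
  assumes "coprime a b" "a dvd b * c"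
  shows "a dvd c"
proof -
  obtain r t where "r * a + t * b = 1"
    using assms(1) unfolding coprime_iff_bezout by blast
  then have "(r * a + t * b) * c = c" by simp
  then have "c = a * (r * c) + t * (b * c)" by (simp add: algebra_simps)
  then show ?thesis using assms(2) by (metis dvd_add dvd_mult dvd_triv_left)
qed

lemma coprime_dvd_left_mono:
  fixes a b c :: "'r::algebraic_semidom"
  assumes "coprime b c" "a dvd b"
  shows "coprime a c"
  using assms unfolding coprime_def by (meson dvd_trans)

lemma coprime_add_mult_iff:
  fixes a b c :: "'r::{algebraic_semidom,comm_ring_1}"
  shows "coprime a (b + a * c) \<longleftrightarrow> coprime a b"
  unfolding coprime_def by (metis dvd_add_left_iff dvd_mult2)

lemma euclid_irreducible_prime:
  fixes p a b :: "'r::euclidean_ring"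
  assumes "Factorial_Ring.irreducible p"
  shows "p dvd a \<or> coprime p a"
proof (cases "coprime p a")
  case False
  then obtain c where c: "c dvd p" "c dvd a" "\<not> is_unit c"
    unfolding coprime_def by blast
  then have "p dvd c" using assms by (metis irreducibleD')
  then show ?thesis using c(2) dvd_trans by blast
qed simp

lemma euclid_prime_dvd_mult:
  fixes p a b :: "'r::euclidean_ring"
  assumes "Factorial_Ring.irreducible p" "p dvd a * b"
  shows "p dvd a \<or> p dvd b"
  using euclid_irreducible_prime[OF assms(1), of a] euclid_coprime_dvd_mult[OF _ assms(2)] by blast

lemma euclid_prime_dvd_power:
  fixes p a :: "'r::euclidean_ring"
  assumes "Factorial_Ring.irreducible p" "p dvd a ^ k"
  shows "p dvd a"
  using assms(2)
proof (induction k)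
  case 0
  then show ?case using assms(1) unfolding Factorial_Ring.irreducible_def by simp
qed (use euclid_prime_dvd_mult[OF assms(1)] in auto)

lemma euclid_irreducible_factor:
  fixes a :: "'r::euclidean_ring"
  assumes "a \<noteq> 0" "\<not> is_unit a"
  shows "\<exists>p. Factorial_Ring.irreducible p \<and> p dvd a"
  using assms
proof (induction "euclidean_size a" arbitrary: a rule: less_induct)
  case less
  show ?case
  proof (cases "Factorial_Ring.irreducible a")
    case False
    then obtain b c where bc: "a = b * c" "\<not> is_unit b" "\<not> is_unit c"
      using less.prems unfolding Factorial_Ring.irreducible_def by blast
    have "b \<noteq> 0" using bc less.prems by auto
    moreover have "euclidean_size b < euclidean_size a"
      using bc less.prems
      by (metis dvd_euclidean_size_eq_imp_dvd dvd_mult_unit_iff' dvd_triv_left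
          euclidean_size_times_nonunit mult.commute mult_eq_0_iff)
    ultimately show ?thesis using less.hyps[of b] bc by (metis dvd_mult2)
  qed auto
qed

lemma euclid_common_prime:
  fixes a b :: "'r::euclidean_ring"
  assumes "\<not> coprime a b" "a \<noteq> 0"
  shows "\<exists>p. Factorial_Ring.irreducible p \<and> p dvd a \<and> p dvd b"
proof -
  obtain c where c: "c dvd a" "c dvd b" "\<not> is_unit c"
    using assms unfolding coprime_def by blast
  moreover have "c \<noteq> 0" using c assms by auto
  ultimately show ?thesis using euclid_irreducible_factor by (meson dvd_trans)
qed

lemma euclid_prime_power_split:
  fixes p a :: "'r::euclidean_ring"
  assumes "Factorial_Ring.irreducible p" "a \<noteq> 0"
  shows "\<exists>k b. a = p ^ k * b \<and> coprime p b"
  using assms(2)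
proof (induction "euclidean_size a" arbitrary: a rule: less_induct)
  case less
  have up: "\<not> is_unit p" using assms(1) unfolding Factorial_Ring.irreducible_def by blast
  show ?case
  proof (cases "p dvd a")
    case False
    then show ?thesis using euclid_irreducible_prime[OF assms(1), of a]
      by (metis mult_1 power_0)
  next
    case True
    then obtain c where c: "a = p * c" by (elim dvdE)
    have "c \<noteq> 0" using c less.prems by auto
    moreover have "euclidean_size c < euclidean_size a"
      using c less.prems up by (metis euclidean_size_times_nonunit mult_eq_0_iff)
    ultimately obtain k b where "c = p ^ k * b" "coprime p b"
      using less.hyps by blast
    then show ?thesis using c by (metis mult.assoc power_Suc)
  qed
qed

lemma euclid_reduced_fraction:
  fixes a b :: "'r::euclidean_ring"
  assumes "b \<noteq> 0"
  shows "\<exists>g a' b'. a = g * a' \<and> b = g * b' \<and> g \<noteq> 0 \<and> b' \<noteq> 0 \<and> coprime a' b'"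
proof -
  obtain g r t where g: "g = r * a + t * b" "g dvd a" "g dvd b"
    using euclid_gcd_exists by blast
  obtain a' where a': "a = g * a'" using g(2) by (rule dvdE)
  obtain b' where b': "b = g * b'" using g(3) by (rule dvdE)
  note ab = a' b'
  have g0: "g \<noteq> 0" using ab assms by auto
  have "g * (r * a' + t * b') = g * 1"
    using g(1) ab by (simp add: algebra_simps)
  then have "r * a' + t * b' = 1" using g0 mult_left_cancel by blast
  then have "coprime a' b'" unfolding coprime_iff_bezout by blast
  then show ?thesis using ab g0 assms by auto
qed

lemma finite_degree_le:
  "finite {p :: 'a::{finite,zero} poly. Polynomial.degree p \<le> n}"
proof (rule finite_subset)
  show "{p :: 'a poly. Polynomial.degree p \<le> n}
      \<subseteq> Poly ` {xs. set xs \<subseteq> UNIV \<and> length xs \<le> Suc n}"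
  proof
    fix p :: "'a poly" assume "p \<in> {p. Polynomial.degree p \<le> n}"
    then have "length (coeffs p) \<le> Suc n"
      by (cases "p = 0") (auto simp: length_coeffs_degree)
    then show "p \<in> Poly ` {xs. set xs \<subseteq> UNIV \<and> length xs \<le> Suc n}"
      by (intro image_eqI[of _ _ "coeffs p"]) auto
  qed
qed (rule finite_imageI, rule finite_lists_length_le, simp)

text \<open>The first factor collects the prime powers of \<open>n\<close> that already divide \<open>a\<close>.\<close>
lemma dvd_lcm_split:
  fixes n a b :: nat
  assumes "n dvd lcm a b" "n > 0" "a > 0" "b > 0"
  shows "\<exists>u v. n = u * v \<and> coprime u v \<and> u dvd a \<and> v dvd b"
proof -
  define A where "A = {p \<in> prime_factors n. multiplicity p n \<le> multiplicity p a}"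
  define B where "B = prime_factors n - A"
  define u where "u = (\<Prod>p\<in>A. p ^ multiplicity p n)"
  define v where "v = (\<Prod>p\<in>B. p ^ multiplicity p n)"
  have fin: "finite A" "finite B" and pA: "\<And>p. p \<in> A \<Longrightarrow> prime p" and pB: "\<And>p. p \<in> B \<Longrightarrow> prime p"
    unfolding A_def B_def by auto
  have "n = (\<Prod>p\<in>prime_factors n. p ^ multiplicity p n)"
    using assms(2) by (simp add: prime_factorization_nat)
  also have "prime_factors n = A \<union> B" unfolding A_def B_def by auto
  also have "(\<Prod>p\<in>A \<union> B. p ^ multiplicity p n) = u * v"
    unfolding u_def v_def using fin by (intro prod.union_disjoint) (auto simp: B_def)
  finally have n: "n = u * v" .
  have "coprime (p ^ multiplicity p n) (q ^ multiplicity q n)" if "p \<in> A" "q \<in> B" for p q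
    using that pA pB by (metis B_def DiffD2 coprime_power_left_iff coprime_power_right_iff primes_coprime)
  then have cop: "coprime u v"
    unfolding u_def v_def by (intro prod_coprime_left prod_coprime_right) auto
  have mult: "multiplicity p n \<le> max (multiplicity p a) (multiplicity p b)" if "prime p" for p
    using assms that
    by (metis dvd_imp_multiplicity_le lcm_pos_nat less_not_refl2 multiplicity_lcm
        prime_imp_prime_elem)
  have pow: "(\<Prod>p\<in>S. p ^ multiplicity p n) dvd c"
    if "finite S" "\<And>p. p \<in> S \<Longrightarrow> prime p" "\<And>p. p \<in> S \<Longrightarrow> multiplicity p n \<le> multiplicity p c"
    for S and c :: nat
    using that
  proof (induction S rule: finite_induct)
    case (insert p S)
    have "p ^ multiplicity p n dvd c" using insert.prems by (simp add: multiplicity_dvd')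
    moreover have "coprime (p ^ multiplicity p n) (\<Prod>p\<in>S. p ^ multiplicity p n)"
      using insert by (intro prod_coprime_right)
        (metis coprime_power_left_iff coprime_power_right_iff insertI1 insertI2 primes_coprime)
    ultimately show ?case using insert by (simp add: divides_mult)
  qed simp
  have "u dvd a" unfolding u_def using fin pA by (intro pow) (auto simp: A_def)
  moreover have "v dvd b" unfolding v_def
  proof (intro pow)
    fix p assume "p \<in> B"
    then have "\<not> multiplicity p n \<le> multiplicity p a" "prime p"
      using pB by (auto simp: A_def B_def)
    then show "multiplicity p n \<le> multiplicity p b" using mult[of p] by auto
  qed (use fin pB in auto)
  ultimately show ?thesis using n cop by blast
qed

section \<open>Integers of the quadratic field\<close>

lemma emb_0 [simp]: "emb 0 = 0"
  and emb_1 [simp]: "emb 1 = 1"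
  and emb_add [simp]: "emb (p + q) = emb p + emb q"
  and emb_diff [simp]: "emb (p - q) = emb p - emb q"
  and emb_minus [simp]: "emb (- p) = - emb p"
  and emb_mult [simp]: "emb (p * q) = emb p * emb q"
  by (simp_all add: emb_def)

lemma emb_power [simp]: "emb (p ^ k) = emb p ^ k"
  by (induction k) simp_all

lemma emb_numeral [simp]: "emb (numeral k) = numeral k"
proof -
  have "emb (of_nat j) = of_nat j" for j
    by (induction j) simp_all
  from this[of "numeral k"] show ?thesis by simp
qed

lemma emb_eq_iff [simp]: "emb p = emb q \<longleftrightarrow> p = q"
  by (simp add: emb_def)

lemma emb_eq_0_iff [simp]: "emb p = 0 \<longleftrightarrow> p = 0"
  using emb_eq_iff[of p 0] by simp

lemma to_fract_power [simp]: "to_fract (a ^ i) = to_fract a ^ i"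
  by (induction i) simp_all

lemma case_prod_rangeI [simp, intro]: "f x y \<in> range (case_prod f)"
  by (rule image_eqI[of _ _ "(x, y)"]) simp_all

definition elt :: "'a::field poly \<Rightarrow> 'a poly \<Rightarrow> 'a poly \<Rightarrow> 'a poly fract alg_closure" where
  "elt D x y = emb x + emb y * sqrt_elt D"

definition kelt :: "'a::field poly \<Rightarrow> 'a poly fract \<Rightarrow> 'a poly fract \<Rightarrow> 'a poly fract alg_closure" where
  "kelt D u v = to_ac u + to_ac v * sqrt_elt D"

lemma sqrt_elt_mult_self: "sqrt_elt D * sqrt_elt D = emb D"
  using sqrt_elt_square[of D] by (simp add: power2_eq_square)

lemma sqrt_elt_mult_left: "sqrt_elt D * (sqrt_elt D * z) = emb D * z"
  using sqrt_elt_mult_self[of D] by (simp flip: mult.assoc)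

lemma elt_kelt: "elt D x y = kelt D (to_fract x) (to_fract y)"
  by (simp add: elt_def kelt_def emb_def)

lemma elt_add: "elt D a b + elt D c d = elt D (a + c) (b + d)"
  and elt_diff: "elt D a b - elt D c d = elt D (a - c) (b - d)"
  and elt_minus: "- elt D a b = elt D (- a) (- b)"
  and elt_mult: "elt D a b * elt D c d = elt D (a * c + D * b * d) (a * d + b * c)"
  and emb_elt: "emb a = elt D a 0"
  and elt_0 [simp]: "elt D 0 0 = 0"
  by (simp_all add: elt_def algebra_simps sqrt_elt_mult_self sqrt_elt_mult_left)

lemma emb_mult_elt: "emb c * elt D a b = elt D (c * a) (c * b)"
  by (simp add: elt_def algebra_simps)

lemma kelt_add: "kelt D a b + kelt D c d = kelt D (a + c) (b + d)"
  and kelt_minus: "- kelt D a b = kelt D (- a) (- b)"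
  and kelt_mult: "kelt D a b * kelt D c d
      = kelt D (a * c + to_fract D * b * d) (a * d + b * c)"
  and to_ac_kelt: "to_ac a = kelt D a 0"
  by (simp_all add: kelt_def algebra_simps sqrt_elt_mult_self sqrt_elt_mult_left emb_def)

lemma fract_reduced:
  fixes w :: "'a::field poly fract"
  shows "\<exists>a b. b \<noteq> 0 \<and> coprime a b \<and> w * to_fract b = to_fract a"
proof -
  obtain x y where w: "w = Fract x y" "y \<noteq> 0" by (cases w) auto
  from euclid_reduced_fraction[OF w(2), of x] obtain g a b
    where ab: "x = g * a" "y = g * b" "g \<noteq> 0" "b \<noteq> 0" "coprime a b" by blast
  have "w * to_fract b = to_fract a"
    using ab w by (simp add: to_fract_def eq_fract algebra_simps)
  then show ?thesis using ab by blast
qed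

text \<open>In lowest terms \<open>w = a / b\<close>, every power \<open>b ^ i\<close> has to divide
  the fixed \<open>d\<close>, so \<open>b\<close> is a unit: a common denominator for all powers of
  \<open>w\<close> forces \<open>w\<close> itself to be a polynomial.\<close>

lemma fract_bounded_powers_integral:
  fixes w :: "'a::field poly fract"
  assumes d: "d \<noteq> 0" and pow: "\<And>i. to_fract d * w ^ i \<in> range to_fract"
  shows "w \<in> range to_fract"
proof -
  obtain a b where ab: "b \<noteq> 0" "coprime a b" "w * to_fract b = to_fract a"
    using fract_reduced by blast
  have "b ^ i dvd d" for i
  proof -
    obtain c where c: "to_fract d * w ^ i = to_fract c" using pow[of i] by blast
    have "to_fract (d * a ^ i) = to_fract d * (w * to_fract b) ^ i"
      by (simp add: ab(3))
    also have "\<dots> = to_fract d * w ^ i * to_fract b ^ i"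
      by (simp add: power_mult_distrib mult.assoc)
    also have "\<dots> = to_fract (c * b ^ i)"
      using c by simp
    finally have "d * a ^ i = c * b ^ i" by (simp only: to_fract_eq_iff)
    then have "b ^ i dvd a ^ i * d" by (metis dvd_triv_right mult.commute)
    moreover have "coprime (b ^ i) (a ^ i)"
      using ab(2) by (metis coprime_commute euclid_coprime_power)
    ultimately show ?thesis using euclid_coprime_dvd_mult by blast
  qed
  \<comment> \<open>This exponent exceeds the degree of \<open>d\<close>, so a non-constant
    \<open>b\<close> would give a divisor of too large a degree.\<close>
  from dvd_imp_degree_le[OF this[of "Suc (Polynomial.degree d)"] d]
  have "Suc (Polynomial.degree d) * Polynomial.degree b \<le> Polynomial.degree d"
    using ab(1) by (simp add: degree_power_eq del: power_Suc)
  then have "Polynomial.degree b = 0"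
    by (cases "Polynomial.degree b") auto
  then have "is_unit b" using ab(1) by (simp add: is_unit_iff_degree)
  then obtain b' where b': "b * b' = 1" by (metis dvdE)
  have "w = w * to_fract (b * b')" by (simp add: b')
  also have "\<dots> = to_fract (a * b')" using ab(3) by (simp flip: mult.assoc)
  finally show ?thesis by blast
qed

section \<open>Independence of 1 and \<open>s\<close>, norms and inverses in the quadratic
  field\<close>

locale real_quadratic_field =
  fixes D :: "'a::{finite,field} poly"
  assumes odd_card: "odd CARD('a)"
    and rq: "real_quadratic D"
begin

text \<open>Translation by 1 permutes the finite field, so summing all its elements shows that
  \<open>CARD('a)\<close> vanishes in it; if 2 were zero, this odd number would equal 1.\<close>

lemma two_neq_0: "(2::'a) \<noteq> 0"
proof
  assume two: "(2::'a) = 0"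
  have "(\<Sum>x\<in>UNIV. x + 1) = (\<Sum>x\<in>(UNIV::'a set). x)"
    by (rule sum.reindex_bij_witness[of _ "\<lambda>x. x - 1" "\<lambda>x. x + 1"]) auto
  then have "of_nat CARD('a) = (0::'a)"
    by (simp add: sum.distrib)
  moreover obtain k where "CARD('a) = 2 * k + 1" using odd_card oddE by blast
  ultimately show False using two by simp
qed

lemma two_eq: "(2::'a poly) = [:2:]"
  by (rule numeral_poly)

lemma is_unit_two: "is_unit (2::'a poly)"
  using two_neq_0 by (simp add: two_eq is_unit_iff_degree)

lemma squarefree_D: "squarefree D" and degree_D: "Polynomial.degree D > 0"
  using rq by (auto simp: real_quadratic_def)

lemma D_neq_0: "D \<noteq> 0"
  using degree_D by auto

lemma not_unit_D: "\<not> is_unit D"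
  using degree_D D_neq_0 by (simp add: is_unit_iff_degree)

text \<open>For \<open>w = a / b\<close> in lowest terms, \<open>a\<^sup>2 = D b\<^sup>2\<close>
  makes \<open>b\<close> a unit; then \<open>a\<^sup>2\<close> divides the square-free
  \<open>D\<close>, so \<open>a\<close>, and with it \<open>D\<close>, would be a unit. Linear
  independence of 1 and \<open>s\<close> over \<open>k\<close> rests on this.\<close>

lemma D_not_square: "w * w \<noteq> to_fract D"
proof
  assume w: "w * w = to_fract D"
  obtain a b where ab: "b \<noteq> 0" "coprime a b" "w * to_fract b = to_fract a"
    using fract_reduced by blast
  have "to_fract (D * b ^ 2) = w * w * (to_fract b * to_fract b)"
    by (simp add: w power2_eq_square)
  also have "\<dots> = (w * to_fract b) * (w * to_fract b)" by (simp only: mult_ac)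
  also have "\<dots> = to_fract (a ^ 2)" by (simp add: ab(3) power2_eq_square)
  finally have "to_fract (D * b ^ 2) = to_fract (a ^ 2)" .
  then have eq: "D * b ^ 2 = a ^ 2" by (simp only: to_fract_eq_iff)
  have "coprime (b ^ 2) (a ^ 2)"
    using ab(2) by (metis coprime_commute euclid_coprime_power)
  moreover have "b ^ 2 dvd a ^ 2" by (metis eq dvd_triv_right)
  ultimately have "is_unit (b ^ 2)" by (metis coprime_absorb_left)
  then have "a ^ 2 dvd D" using eq by (metis dvd_mult_unit_iff dvd_refl)
  then have "is_unit a" using squarefree_D squarefreeD by blast
  then have "is_unit (D * b ^ 2)" using eq by (simp add: is_unit_power_iff)
  then show False using not_unit_D by (simp add: is_unit_mult_iff)
qed

lemma kelt_eq_iff: "kelt D a b = kelt D c d \<longleftrightarrow> a = c \<and> b = d"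
proof
  assume eq: "kelt D a b = kelt D c d"
  have "b = d"
  proof (rule ccontr)
    assume bd: "b \<noteq> d"
    have "to_ac (b - d) * sqrt_elt D = to_ac (c - a)"
      using eq by (simp add: kelt_def algebra_simps)
    then have s: "sqrt_elt D = to_ac ((c - a) / (b - d))"
      using bd by (simp add: field_simps del: to_ac_diff)
    have "to_ac (((c - a) / (b - d)) * ((c - a) / (b - d))) = to_ac (to_fract D)"
      unfolding to_ac_mult using sqrt_elt_mult_self[of D] s by (simp add: emb_def)
    then show False using D_not_square by (simp only: to_ac_eq_iff)
  qed
  then show "a = c \<and> b = d" using eq by (simp add: kelt_def)
qed simp

lemma elt_eq_iff: "elt D a b = elt D c d \<longleftrightarrow> a = c \<and> b = d"
  by (simp add: elt_kelt kelt_eq_iff)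

lemma elt_eq_0_iff: "elt D a b = 0 \<longleftrightarrow> a = 0 \<and> b = 0"
  using elt_eq_iff[of a b 0 0] by simp

lemma kelt_eq_0_iff: "kelt D a b = 0 \<longleftrightarrow> a = 0 \<and> b = 0"
  using kelt_eq_iff[of a b 0 0] by (simp add: kelt_def)

text \<open>The norm is the product of \<open>u + v s\<close> and its conjugate, and both are
  non-zero by independence of 1 and \<open>s\<close>.\<close>

lemma norm_neq_0:
  assumes "u \<noteq> 0 \<or> v \<noteq> 0"
  shows "u * u - to_fract D * v * v \<noteq> 0"
proof -
  have "kelt D u v * kelt D u (- v) = to_ac (u * u - to_fract D * v * v)"
    by (simp add: kelt_mult to_ac_kelt[of _ D] algebra_simps)
  moreover have "kelt D u v * kelt D u (- v) \<noteq> 0"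
    using assms by (simp add: kelt_eq_0_iff)
  ultimately show ?thesis by (metis to_ac_0)
qed

lemma poly_norm_neq_0:
  assumes "x \<noteq> 0 \<or> y \<noteq> 0"
  shows "x\<^sup>2 - D * y\<^sup>2 \<noteq> 0"
proof -
  have "to_fract (x * x - D * y * y) \<noteq> 0"
    using norm_neq_0[of "to_fract x" "to_fract y"] assms by simp
  then have "x * x - D * y * y \<noteq> 0" by (metis to_fract_0)
  then show ?thesis by (simp add: power2_eq_square mult.assoc)
qed

lemma kelt_inverse:
  assumes "kelt D u v \<noteq> 0"
  shows "inverse (kelt D u v) \<in> range (case_prod (kelt D))"
proof -
  define N where "N = u * u - to_fract D * v * v"
  have N: "N \<noteq> 0" using norm_neq_0[of u v] assms by (auto simp: N_def kelt_eq_0_iff)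
  have "kelt D u v * kelt D (u / N) (- v / N) = kelt D ((u * u - to_fract D * v * v) / N) 0"
    unfolding kelt_mult by (simp add: diff_divide_distrib add_divide_distrib algebra_simps)
  also have "\<dots> = 1" using N by (simp add: N_def[symmetric] kelt_def)
  finally have "inverse (kelt D u v) = kelt D (u / N) (- v / N)"
    by (rule inverse_unique)
  then show ?thesis by auto
qed

text \<open>The elements \<open>u + v s\<close> are already closed under the field operations, the
  inverse being the conjugate divided by the norm.\<close>

lemma quad_field_eq: "quad_field D = range (case_prod (kelt D))"
proof
  \<comment> \<open>The inverses of the ring record have to be identified with those of the type
    before the induction over the generated field.\<close>
  have m_inv_ring: "inv\<^bsub>ring_of_type_algebra\<^esub> h = inverse h" if "h \<noteq> 0"
    for h :: "'a poly fract alg_closure"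
  proof -
    interpret F: cring "ring_of_type_algebra :: 'a poly fract alg_closure ring"
      by (rule cring_from_type_algebra)
    show ?thesis using that
      by (intro F.comm_inv_char) (auto simp: ring_of_type_algebra_def)
  qed
  have a_inv_ring: "\<ominus>\<^bsub>ring_of_type_algebra\<^esub> h = - h" for h :: "'a poly fract alg_closure"
  proof -
    interpret F: ring "ring_of_type_algebra :: 'a poly fract alg_closure ring"
      by (rule ring_from_type_algebra)
    show ?thesis
      by (rule F.minus_equality) (auto simp: ring_of_type_algebra_def)
  qed
  show "quad_field D \<subseteq> range (case_prod (kelt D))"
  proof
    fix x assume "x \<in> quad_field D"
    then show "x \<in> range (case_prod (kelt D))"
      unfolding quad_field_def
    proof (induction rule: generate_field.induct)
      case one
      show ?case by (auto simp: ring_of_type_algebra_def kelt_def intro!: image_eqI[of _ _ "(1, 0)"])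
    next
      case (incl h)
      then consider "h = sqrt_elt D" | u where "h = to_ac u" by blast
      then show ?case
      proof cases
        case 1
        then show ?thesis by (auto simp: kelt_def intro!: image_eqI[of _ _ "(0, 1)"])
      next
        case (2 u)
        then show ?thesis by (auto simp: kelt_def intro!: image_eqI[of _ _ "(u, 0)"])
      qed
    next
      case (a_inv h)
      then show ?case unfolding a_inv_ring by (auto simp: kelt_minus)
    next
      case (m_inv h)
      then have "h \<noteq> 0" by (simp add: ring_of_type_algebra_def)
      then show ?case unfolding m_inv_ring[OF \<open>h \<noteq> 0\<close>] using m_inv kelt_inverse by auto
    next
      case (eng_add h1 h2)
      then show ?case by (auto simp: ring_of_type_algebra_def kelt_add)
    next
      case (eng_mult h1 h2)
      then show ?case by (auto simp: ring_of_type_algebra_def kelt_mult)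
    qed
  qed
  have "kelt D u v \<in> quad_field D" for u v
  proof -
    have "to_ac u \<in> quad_field D" "to_ac v \<in> quad_field D" "sqrt_elt D \<in> quad_field D"
      unfolding quad_field_def by (auto intro: generate_field.incl)
    then show ?thesis
      unfolding quad_field_def kelt_def
      by (metis (no_types, lifting) generate_field.eng_add generate_field.eng_mult
          ring.simps(2) ring_of_type_algebra_def monoid.simps(1))
  qed
  then show "range (case_prod (kelt D)) \<subseteq> quad_field D" by auto
qed

section \<open>The order \<open>R + R s\<close> and its identification with the integral
  closure\<close>

definition OK :: "'a poly fract alg_closure set" where
  "OK = range (case_prod (elt D))"

lemma elt_in_OK [simp, intro]: "elt D a b \<in> OK"
  by (auto simp: OK_def)

lemma OK_add: "x \<in> OK \<Longrightarrow> y \<in> OK \<Longrightarrow> x + y \<in> OK"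
  and OK_minus: "x \<in> OK \<Longrightarrow> - x \<in> OK"
  and OK_mult: "x \<in> OK \<Longrightarrow> y \<in> OK \<Longrightarrow> x * y \<in> OK"
  and OK_emb [simp, intro]: "emb a \<in> OK"
  and OK_0 [simp, intro]: "0 \<in> OK"
  using case_prod_rangeI[of "elt D" 0 0]
  by (auto simp: OK_def elt_add elt_minus elt_mult emb_elt[of _ D])

lemma OK_1 [simp, intro]: "1 \<in> OK"
  using OK_emb[of 1] by simp

lemma OK_power: "x \<in> OK \<Longrightarrow> x ^ k \<in> OK"
  by (induction k) (auto intro: OK_mult)

lemma OK_sum: "(\<And>i. i \<in> A \<Longrightarrow> f i \<in> OK) \<Longrightarrow> sum f A \<in> OK"
  by (induction A rule: infinite_finite_induct) (auto intro: OK_add)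

lemma OK_of_nat: "of_nat k \<in> OK"
  by (induction k) (auto intro: OK_add)

text \<open>If \<open>B\<close> clears the denominators of \<open>x\<close>, then
  \<open>B ^ n\<close> clears those of \<open>x ^ i\<close> for \<open>i < n\<close>, and the monic
  equation of degree \<open>n\<close> reduces every higher power to lower ones with coefficients in
  \<open>R\<close>.\<close>

lemma integral_bounded_powers:
  assumes p: "Polynomial.lead_coeff p = 1" "poly (map_poly emb p) (kelt D u v) = 0"
  shows "\<exists>d. d \<noteq> 0 \<and> (\<forall>i. emb d * kelt D u v ^ i \<in> OK)"
proof -
  define x where "x = kelt D u v"
  define n where "n = Polynomial.degree p"
  obtain a b where ab: "b \<noteq> 0" "u * to_fract b = to_fract a"
    using fract_reduced by blast
  obtain a' b' where ab': "b' \<noteq> 0" "v * to_fract b' = to_fract a'"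
    using fract_reduced by blast
  define B where "B = b * b'"
  have B0: "B \<noteq> 0" using ab ab' by (simp add: B_def)
  have "emb B * x = kelt D (u * to_fract b * to_fract b') (v * to_fract b' * to_fract b)"
    by (simp add: x_def B_def kelt_def emb_def algebra_simps)
  also have "\<dots> = elt D (a * b') (a' * b)"
    by (simp add: ab ab' elt_kelt)
  finally have Bx: "emb B * x \<in> OK" by simp
  have deg: "Polynomial.degree (map_poly emb p) = n"
    unfolding n_def by (intro degree_map_poly) simp
  have "(\<Sum>i\<le>n. emb (Polynomial.coeff p i) * x ^ i) = 0"
    using p(2) unfolding poly_altdef deg x_def[symmetric] by (simp add: coeff_map_poly)
  then have "x ^ n + (\<Sum>i<n. emb (Polynomial.coeff p i) * x ^ i) = 0"
    using p(1) by (simp add: lessThan_Suc_atMost[symmetric] n_def add.commute)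
  then have xn: "x ^ n = - (\<Sum>i<n. emb (Polynomial.coeff p i) * x ^ i)"
    by (simp add: eq_neg_iff_add_eq_0)
  have "emb (B ^ n) * x ^ i \<in> OK" for i
  proof (induction i rule: less_induct)
    case (less i)
    show ?case
    proof (cases "i < n")
      case True
      then have "emb (B ^ n) * x ^ i = emb (B ^ (n - i)) * (emb B * x) ^ i"
        by (simp add: power_mult_distrib flip: mult.assoc power_add)
      then show ?thesis using Bx by (auto intro!: OK_mult OK_power simp del: emb_power)
    next
      case False
      then have "x ^ i = x ^ (i - n) * x ^ n" by (simp flip: power_add)
      also have "emb (B ^ n) * \<dots>
          = - (\<Sum>j<n. emb (Polynomial.coeff p j) * (emb (B ^ n) * x ^ (i - n + j)))"
        unfolding xn by (simp add: sum_distrib_left power_add mult_ac)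
      also have "\<dots> \<in> OK"
        using False by (intro OK_minus OK_sum OK_mult less OK_emb) auto
      finally show ?thesis .
    qed
  qed
  then show ?thesis using B0 by (intro exI[of _ "B ^ n"]) (auto simp: x_def)
qed

lemma kelt_in_OK_iff: "kelt D u v \<in> OK \<longleftrightarrow> u \<in> range to_fract \<and> v \<in> range to_fract"
proof
  assume "kelt D u v \<in> OK"
  then show "u \<in> range to_fract \<and> v \<in> range to_fract"
    by (auto simp: OK_def elt_kelt kelt_eq_iff)
next
  assume "u \<in> range to_fract \<and> v \<in> range to_fract"
  then show "kelt D u v \<in> OK"
    by (auto simp flip: elt_kelt)
qed

text \<open>Conjugation is multiplicative. Stating both powers together carries information about
  coordinates from an element to its conjugate.\<close>

lemma kelt_power_conj: "\<exists>u' v'. kelt D u v ^ i = kelt D u' v' \<and> kelt D u (- v) ^ i = kelt D u' (- v')"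
proof (induction i)
  case 0
  show ?case by (intro exI[of _ 1] exI[of _ 0]) (simp add: kelt_def)
next
  case (Suc i)
  then obtain u' v' where "kelt D u v ^ i = kelt D u' v'" "kelt D u (- v) ^ i = kelt D u' (- v')"
    by blast
  then show ?case
    by (intro exI[of _ "u * u' + to_fract D * v * v'"] exI[of _ "u * v' + v * u'"])
      (simp add: kelt_mult)
qed

text \<open>Boundedness of the denominators of all powers of an integral element passes to the conjugate,
  and hence to trace and norm.\<close>
lemma integral_imp_OK:
  assumes "Polynomial.lead_coeff p = 1" "poly (map_poly emb p) (kelt D u v) = 0"
  shows "kelt D u v \<in> OK"
proof -
  define x where "x = kelt D u v"
  define x' where "x' = kelt D u (- v)"
  obtain d where d: "d \<noteq> 0" and dx: "\<And>i. emb d * x ^ i \<in> OK"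
    using integral_bounded_powers[OF assms] x_def by auto
  have dx': "emb d * x' ^ i \<in> OK" for i
  proof -
    obtain u' v' where uv: "x ^ i = kelt D u' v'" "x' ^ i = kelt D u' (- v')"
      using kelt_power_conj[of u v i] x_def x'_def by auto
    have e: "emb d * kelt D a b = kelt D (to_fract d * a) (to_fract d * b)" for a b
      by (simp add: kelt_def emb_def algebra_simps)
    from dx[of i] obtain f where f: "to_fract d * v' = to_fract f" and g: "to_fract d * u' \<in> range to_fract"
      unfolding uv e kelt_in_OK_iff by auto
    have "to_fract d * - v' = to_fract (- f)" using f by simp
    then show ?thesis unfolding uv e kelt_in_OK_iff using g by blast
  qed
  have dd: "emb (d * d) * (x ^ i * x' ^ j) \<in> OK" for i j
    using OK_mult[OF dx[of i] dx'[of j]] by (simp add: mult_ac)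
  \<comment> \<open>\<open>d * d\<close> is a common denominator of all
    \<open>x ^ i * x' ^ j\<close>, hence of all powers of the trace and of the norm; both lie in
    \<open>k\<close>, where \<open>fract_bounded_powers_integral\<close> applies.\<close>
  have integral: "w \<in> range to_fract" if "\<And>i. emb (d * d) * to_ac w ^ i \<in> OK" for w
  proof (rule fract_bounded_powers_integral)
    show "d * d \<noteq> 0" using d by simp
    fix i
    have "emb (d * d) * to_ac w ^ i = kelt D (to_fract (d * d) * w ^ i) 0"
      by (simp add: emb_def kelt_def)
    then show "to_fract (d * d) * w ^ i \<in> range to_fract"
      using that[of i] kelt_in_OK_iff by metis
  qed
  have "u + u \<in> range to_fract"
  proof (rule integral)
    fix i
    have "to_ac (u + u) = x + x'" by (simp add: x_def x'_def kelt_def)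
    then have "emb (d * d) * to_ac (u + u) ^ i
        = (\<Sum>k\<le>i. of_nat (i choose k) * (emb (d * d) * (x ^ k * x' ^ (i - k))))"
      by (simp add: binomial_ring sum_distrib_left mult_ac)
    also have "\<dots> \<in> OK" by (intro OK_sum OK_mult OK_of_nat dd)
    finally show "emb (d * d) * to_ac (u + u) ^ i \<in> OK" .
  qed
  then obtain t where t: "u + u = to_fract t" by blast
  \<comment> \<open>The trace \<open>2 u\<close> is a polynomial, and 2 is a unit because
    \<open>q\<close> is odd.\<close>
  obtain h where h: "2 * h = (1::'a poly)" using is_unit_two by (metis dvdE)
  have "h + h = 1" using h by (simp only: mult_2)
  then have "u = u * to_fract (h + h)" by (simp only: to_fract_1 mult_1_right)
  also have "\<dots> = (u + u) * to_fract h"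
    by (simp only: to_fract_add distrib_left distrib_right)
  finally have u: "u = to_fract (t * h)" by (simp add: t)
  have "u * u - to_fract D * v * v \<in> range to_fract"
  proof (rule integral)
    fix i
    have "to_ac (u * u - to_fract D * v * v) = x * x'"
      by (simp add: x_def x'_def kelt_mult to_ac_kelt[of _ D])
    then show "emb (d * d) * to_ac (u * u - to_fract D * v * v) ^ i \<in> OK"
      using dd[of i i] by (simp add: power_mult_distrib)
  qed
  then obtain m where "u * u - to_fract D * v * v = to_fract m" by blast
  then have Dv: "to_fract D * v * v = to_fract (t * h * (t * h) - m)"
    using u by (simp add: algebra_simps)
  define e where "e = t * h * (t * h) - m"
  \<comment> \<open>\<open>D v\<^sup>2\<close> is the polynomial \<open>e\<close>. With
    \<open>v = a / b\<close> in lowest terms, \<open>b\<^sup>2\<close> divides the square-free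
    \<open>D\<close>, so \<open>v\<close> has no denominator.\<close>
  obtain a b where ab: "b \<noteq> 0" "coprime a b" "v * to_fract b = to_fract a"
    using fract_reduced by blast
  have "to_fract (D * a\<^sup>2) = to_fract D * (v * to_fract b) * (v * to_fract b)"
    by (simp add: ab(3) power2_eq_square)
  also have "\<dots> = (to_fract D * v * v) * to_fract b * to_fract b" by (simp add: mult_ac)
  also have "\<dots> = to_fract (e * b\<^sup>2)" by (simp add: Dv e_def power2_eq_square)
  finally have "D * a\<^sup>2 = e * b\<^sup>2" by (simp only: to_fract_eq_iff)
  then have "b\<^sup>2 dvd a\<^sup>2 * D" by (metis dvd_triv_right mult.commute)
  moreover have "coprime (b\<^sup>2) (a\<^sup>2)"
    using ab(2) by (metis coprime_commute euclid_coprime_power)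
  ultimately have "b\<^sup>2 dvd D" by (metis euclid_coprime_dvd_mult)
  then have "is_unit b" using squarefree_D squarefreeD by blast
  then obtain b' where b': "b * b' = 1" by (metis dvdE)
  have "v = v * to_fract (b * b')" by (simp add: b')
  also have "\<dots> = to_fract (a * b')" using ab(3) by (simp flip: mult.assoc)
  finally show ?thesis using u kelt_in_OK_iff by blast
qed

lemma quad_integers_eq: "quad_integers D = OK"
proof
  show "quad_integers D \<subseteq> OK"
    unfolding quad_integers_def quad_field_eq by (auto intro: integral_imp_OK)
  show "OK \<subseteq> quad_integers D"
  proof
    fix x assume "x \<in> OK"
    then obtain a b where x: "x = elt D a b" by (auto simp: OK_def)
    \<comment> \<open>The characteristic polynomial of \<open>x\<close>, built from its norm and
      trace.\<close>
    define p where "p = [: a\<^sup>2 - D * b\<^sup>2, - (2 * a), 1 :]"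
    have "map_poly emb p = [: emb (a\<^sup>2 - D * b\<^sup>2), emb (- (2 * a)), 1 :]"
      by (simp add: p_def map_poly_pCons)
    then have "poly (map_poly emb p) x = 0"
      by (simp add: x elt_def algebra_simps power2_eq_square sqrt_elt_mult_self sqrt_elt_mult_left)
    moreover have "Polynomial.lead_coeff p = 1" by (simp add: p_def)
    moreover have "x \<in> quad_field D" unfolding x elt_kelt quad_field_eq by auto
    ultimately show "x \<in> quad_integers D" unfolding quad_integers_def by blast
  qed
qed

end

section \<open>Ideals of the form \<open>(m, b + s)\<close>\<close>

text \<open>A non-zero element of least Euclidean size divides all others, since remainders stay in
  \<open>Y\<close>.\<close>

lemma euclid_ideal_generator:
  fixes Y :: "'r::euclidean_ring set"
  assumes "0 \<in> Y" and add: "\<And>x y. x \<in> Y \<Longrightarrow> y \<in> Y \<Longrightarrow> x + y \<in> Y"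
    and mult: "\<And>r x. x \<in> Y \<Longrightarrow> r * x \<in> Y"
  shows "\<exists>e\<in>Y. \<forall>y\<in>Y. e dvd y"
proof (cases "Y = {0}")
  case False
  then obtain y where "y \<in> Y \<and> y \<noteq> 0" using assms(1) by blast
  then obtain e where e: "e \<in> Y \<and> e \<noteq> 0"
    and min: "\<And>z. z \<in> Y \<and> z \<noteq> 0 \<Longrightarrow> euclidean_size e \<le> euclidean_size z"
    using ex_has_least_nat[of "\<lambda>z. z \<in> Y \<and> z \<noteq> 0" y euclidean_size] by blast
  have "e dvd z" if z: "z \<in> Y" for z
  proof -
    have "z mod e = z + (- (z div e)) * e"
      using minus_div_mult_eq_mod[of z e] by simp
    also have "\<dots> \<in> Y" using add mult e z by blast
    finally have "z mod e \<in> Y" .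
    then have "z mod e = 0"
      using min[of "z mod e"] mod_size_less[of e z] e by force
    then show ?thesis by (simp add: dvd_eq_mod_eq_0)
  qed
  then show ?thesis using e by blast
qed auto

section \<open>Products of ideals as finite sums of products\<close>

lemma ideal_mult_0: "0 \<in> ideal_mult I J"
  unfolding ideal_mult_def by (intro CollectI exI[of _ 0]) simp

lemma ideal_mult_mem: "x \<in> I \<Longrightarrow> y \<in> J \<Longrightarrow> x * y \<in> ideal_mult I J"
  unfolding ideal_mult_def
  by (intro CollectI exI[of _ "Suc 0"] exI[of _ "\<lambda>_. x"] exI[of _ "\<lambda>_. y"]) simp

lemma ideal_mult_add:
  assumes "x \<in> ideal_mult I J" "y \<in> ideal_mult I J"
  shows "x + y \<in> ideal_mult I J"
proof -
  obtain m f g where x: "x = (\<Sum>i<m::nat. f i * g i)" "\<forall>i<m. f i \<in> I \<and> g i \<in> J"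
    using assms(1) unfolding ideal_mult_def by blast
  obtain m' f' g' where y: "y = (\<Sum>i<m'::nat. f' i * g' i)" "\<forall>i<m'. f' i \<in> I \<and> g' i \<in> J"
    using assms(2) unfolding ideal_mult_def by blast
  \<comment> \<open>\<open>F\<close> and \<open>G\<close> concatenate the two families of factors,
    so that one sum of length \<open>m + m'\<close> represents \<open>x + y\<close>.\<close>
  define F where "F = (\<lambda>i. if i < m then f i else f' (i - m))"
  define G where "G = (\<lambda>i. if i < m then g i else g' (i - m))"
  have "(\<Sum>i<m + k. F i * G i) = x + (\<Sum>i<k. f' i * g' i)" for k
    by (induction k) (simp_all add: F_def G_def x(1) add.assoc)
  then have "x + y = (\<Sum>i<m + m'. F i * G i)" using y(1) by simp
  moreover have "\<forall>i<m + m'. F i \<in> I \<and> G i \<in> J"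
    using x(2) y(2) by (auto simp: F_def G_def)
  ultimately show ?thesis unfolding ideal_mult_def by blast
qed

text \<open>The way in which products are bounded from above throughout: only single products and
  closure under addition have to be checked.\<close>

lemma ideal_mult_least:
  fixes I J W :: "'b::comm_ring_1 set"
  assumes "0 \<in> W" "\<And>x y. x \<in> W \<Longrightarrow> y \<in> W \<Longrightarrow> x + y \<in> W"
    "\<And>x y. x \<in> I \<Longrightarrow> y \<in> J \<Longrightarrow> x * y \<in> W"
  shows "ideal_mult I J \<subseteq> W"
proof
  fix z assume "z \<in> ideal_mult I J"
  then obtain m f g where z: "z = (\<Sum>i<m::nat. f i * g i)" "\<forall>i<m. f i \<in> I \<and> g i \<in> J"
    unfolding ideal_mult_def by blast
  have "k \<le> m \<Longrightarrow> (\<Sum>i<k. f i * g i) \<in> W" for k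
    by (induction k) (use assms z(2) in auto)
  then show "z \<in> W" using z(1) by simp
qed

lemma ideal_mult_commute: "ideal_mult I J = ideal_mult J I"
proof -
  have "ideal_mult I J \<subseteq> ideal_mult J I" for I J :: "'b::comm_ring_1 set"
  proof (rule ideal_mult_least)
    fix x y assume "x \<in> I" "y \<in> J"
    then show "x * y \<in> ideal_mult J I" using ideal_mult_mem[of y J x I] by (simp add: mult.commute)
  qed (auto intro: ideal_mult_0 ideal_mult_add)
  then show ?thesis by blast
qed

lemma ideal_mult_assoc: "ideal_mult (ideal_mult I J) L = ideal_mult I (ideal_mult J L)"
proof -
  have sub: "ideal_mult (ideal_mult I J) L \<subseteq> ideal_mult I (ideal_mult J L)" (is "_ \<subseteq> ?R")
    for I J L :: "'b::comm_ring_1 set"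
  proof (rule ideal_mult_least)
    fix x y assume "x \<in> ideal_mult I J" and y: "y \<in> L"
    moreover have "ideal_mult I J \<subseteq> {x. x * y \<in> ?R}"
    proof (rule ideal_mult_least)
      fix u v assume "u \<in> I" "v \<in> J"
      then have "u * (v * y) \<in> ?R" using y by (intro ideal_mult_mem)
      then show "u * v \<in> {x. x * y \<in> ?R}" by (simp add: mult.assoc)
    qed (auto simp: distrib_right intro: ideal_mult_0 ideal_mult_add)
    ultimately show "x * y \<in> ?R" by blast
  qed (auto intro: ideal_mult_0 ideal_mult_add)
  \<comment> \<open>By commutativity the reverse inclusion is an instance of the first with the
    factors in reverse order.\<close>
  have "ideal_mult I (ideal_mult J L) = ideal_mult (ideal_mult L J) I"
    by (simp only: ideal_mult_commute)
  also have "\<dots> \<subseteq> ideal_mult L (ideal_mult J I)" by (rule sub)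
  also have "\<dots> = ideal_mult (ideal_mult I J) L"
    by (simp only: ideal_mult_commute)
  finally show ?thesis using sub by blast
qed

context real_quadratic_field
begin

abbreviation K where "K \<equiv> quad_field D"

lemma K_kelt [simp, intro]: "kelt D u v \<in> K"
  by (simp add: quad_field_eq)

lemma K_elt [simp, intro]: "elt D u v \<in> K"
  by (simp add: elt_kelt)

lemma K_mult: "x \<in> K \<Longrightarrow> y \<in> K \<Longrightarrow> x * y \<in> K"
  by (auto simp: quad_field_eq kelt_mult)

lemma K_inverse: "x \<in> K \<Longrightarrow> inverse x \<in> K"
  using kelt_inverse by (cases "x = 0") (auto simp: quad_field_eq)

lemma OK_subset_K: "OK \<subseteq> K"
  by (auto simp: OK_def)

lemma K_emb [simp, intro]: "emb a \<in> K"
  using OK_subset_K by auto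

lemma K_add: "x \<in> K \<Longrightarrow> y \<in> K \<Longrightarrow> x + y \<in> K"
  by (auto simp: quad_field_eq kelt_add)

section \<open>Modules over the ring of integers and their multiples\<close>

definition omodule :: "'a poly fract alg_closure set \<Rightarrow> bool" where
  "omodule J \<longleftrightarrow> 0 \<in> J \<and> (\<forall>x\<in>J. \<forall>y\<in>J. x + y \<in> J) \<and> (\<forall>a\<in>OK. \<forall>x\<in>J. a * x \<in> J)"

lemma omodule_0: "omodule J \<Longrightarrow> 0 \<in> J"
  and omodule_add: "omodule J \<Longrightarrow> x \<in> J \<Longrightarrow> y \<in> J \<Longrightarrow> x + y \<in> J"
  and omodule_mult: "omodule J \<Longrightarrow> a \<in> OK \<Longrightarrow> x \<in> J \<Longrightarrow> a * x \<in> J"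
  and omodule_mult': "omodule J \<Longrightarrow> a \<in> OK \<Longrightarrow> x \<in> J \<Longrightarrow> x * a \<in> J"
  by (auto simp: omodule_def mult.commute)

lemma omodule_diff: "omodule J \<Longrightarrow> x \<in> J \<Longrightarrow> y \<in> J \<Longrightarrow> x - y \<in> J"
  using omodule_add[of J x "- 1 * y"] omodule_mult[of J "- 1" y] OK_minus[OF OK_1] by simp

lemma omodule_OK: "omodule OK"
  by (auto simp: omodule_def intro: OK_add OK_mult)

lemma omodule_ideal_mult:
  assumes "omodule J"
  shows "omodule (ideal_mult I J)"
  unfolding omodule_def
proof (intro conjI ballI)
  fix a x assume a: "a \<in> OK" and x: "x \<in> ideal_mult I J"
  have "ideal_mult I J \<subseteq> {x. a * x \<in> ideal_mult I J}"
  proof (rule ideal_mult_least)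
    fix x y assume "x \<in> I" "y \<in> J"
    then have "x * (a * y) \<in> ideal_mult I J"
      using assms a by (intro ideal_mult_mem omodule_mult)
    then show "x * y \<in> {x. a * x \<in> ideal_mult I J}" by (simp add: mult_ac)
  qed (auto simp: distrib_left intro: ideal_mult_0 ideal_mult_add)
  then show "a * x \<in> ideal_mult I J" using x by blast
qed (auto intro: ideal_mult_0 ideal_mult_add)

abbreviation scale :: "'a poly fract alg_closure \<Rightarrow> _ set \<Rightarrow> _ set" where
  "scale x J \<equiv> (\<lambda>a. x * a) ` J"

lemma omodule_scale:
  assumes "omodule J"
  shows "omodule (scale x J)"
  unfolding omodule_def
proof (intro conjI ballI)
  show "0 \<in> scale x J" using omodule_0[OF assms] by force
  show "u + v \<in> scale x J" if "u \<in> scale x J" "v \<in> scale x J" for u v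
    using that omodule_add[OF assms] by (auto simp flip: distrib_left)
  show "a * u \<in> scale x J" if "a \<in> OK" "u \<in> scale x J" for a u
    using that omodule_mult[OF assms] by (auto simp: mult.left_commute)
qed

lemma scale_scale: "scale x (scale y J) = scale (x * y) J"
  by (simp add: image_image mult.assoc)

lemma ideal_mult_scale:
  "ideal_mult (scale x I) (scale y J) = scale (x * y) (ideal_mult I J)"
proof
  show "ideal_mult (scale x I) (scale y J) \<subseteq> scale (x * y) (ideal_mult I J)"
  proof (rule ideal_mult_least)
    show "0 \<in> scale (x * y) (ideal_mult I J)"
      by (rule image_eqI[OF _ ideal_mult_0]) simp
    show "u + v \<in> scale (x * y) (ideal_mult I J)"
      if "u \<in> scale (x * y) (ideal_mult I J)" "v \<in> scale (x * y) (ideal_mult I J)" for u v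
      using that by (auto intro: ideal_mult_add simp flip: distrib_left)
    show "u * v \<in> scale (x * y) (ideal_mult I J)"
      if uv: "u \<in> scale x I" "v \<in> scale y J" for u v
    proof -
      obtain i j where "u = x * i" "v = y * j" "i \<in> I" "j \<in> J" using uv by blast
      then show ?thesis
        by (intro image_eqI[OF _ ideal_mult_mem[of i I j J]]) (simp_all add: mult_ac)
    qed
  qed
  have "ideal_mult I J \<subseteq> {z. x * y * z \<in> ideal_mult (scale x I) (scale y J)}" (is "_ \<subseteq> ?W")
  proof (rule ideal_mult_least)
    fix u v assume "u \<in> I" "v \<in> J"
    then have "(x * u) * (y * v) \<in> ideal_mult (scale x I) (scale y J)"
      by (intro ideal_mult_mem) auto
    then show "u * v \<in> ?W" by (simp add: mult_ac)
  qed (auto simp: distrib_left intro: ideal_mult_0 ideal_mult_add)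
  then show "scale (x * y) (ideal_mult I J) \<subseteq> ideal_mult (scale x I) (scale y J)" by blast
qed

lemma ideal_mult_OK:
  assumes "omodule J"
  shows "ideal_mult OK J = J"
proof
  show "ideal_mult OK J \<subseteq> J"
    by (rule ideal_mult_least) (use assms in \<open>auto simp: omodule_def\<close>)
  show "J \<subseteq> ideal_mult OK J"
    using ideal_mult_mem[OF OK_1] by force
qed

lemma ideal_mult_principal:
  assumes "omodule J"
  shows "ideal_mult (scale x OK) J = scale x J"
  using ideal_mult_scale[of x OK 1 J] ideal_mult_OK[OF assms] by simp

text \<open>If \<open>m\<close> divides \<open>b\<^sup>2 - D\<close>, this is the ideal attached to
  the binary quadratic form \<open>(m, 2 b, c)\<close> with
  \<open>b\<^sup>2 - m c = D\<close>.\<close>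

definition qideal :: "'a poly \<Rightarrow> 'a poly \<Rightarrow> 'a poly fract alg_closure set" where
  "qideal m b = {emb m * u + elt D b 1 * v | u v. u \<in> OK \<and> v \<in> OK}"

lemma omodule_qideal: "omodule (qideal m b)"
  unfolding omodule_def
proof (intro conjI ballI)
  show "0 \<in> qideal m b" unfolding qideal_def by (intro CollectI exI[of _ 0]) simp
  show "x + y \<in> qideal m b" if xy: "x \<in> qideal m b" "y \<in> qideal m b" for x y
  proof -
    obtain u v u' v' where *: "x = emb m * u + elt D b 1 * v" "y = emb m * u' + elt D b 1 * v'"
      "u \<in> OK" "v \<in> OK" "u' \<in> OK" "v' \<in> OK"
      using xy unfolding qideal_def by blast
    then have "x + y = emb m * (u + u') + elt D b 1 * (v + v')" by (simp add: algebra_simps)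
    then show ?thesis unfolding qideal_def using * OK_add by blast
  qed
  show "a * x \<in> qideal m b" if ax: "a \<in> OK" "x \<in> qideal m b" for a x
  proof -
    obtain u v where *: "x = emb m * u + elt D b 1 * v" "u \<in> OK" "v \<in> OK"
      using ax unfolding qideal_def by blast
    then have "a * x = emb m * (a * u) + elt D b 1 * (a * v)" by (simp add: algebra_simps)
    then show ?thesis unfolding qideal_def using * ax OK_mult by blast
  qed
qed

lemma qideal_gen1: "emb m \<in> qideal m b"
  unfolding qideal_def by (intro CollectI exI[of _ 1] exI[of _ 0]) simp

lemma qideal_gen2: "elt D b 1 \<in> qideal m b"
  unfolding qideal_def by (intro CollectI exI[of _ 0] exI[of _ 1]) simp

lemma qideal_least:
  assumes "omodule J" "emb m \<in> J" "elt D b 1 \<in> J"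
  shows "qideal m b \<subseteq> J"
  unfolding qideal_def using assms by (auto intro: omodule_add omodule_mult')

lemma scale_qideal_least:
  assumes J: "omodule J" "x * emb m \<in> J" "x * elt D b 1 \<in> J"
  shows "scale x (qideal m b) \<subseteq> J"
proof -
  have "x * (emb m * u + elt D b 1 * v) \<in> J" if "u \<in> OK" "v \<in> OK" for u v
    using omodule_add[OF J(1) omodule_mult'[OF J(1) that(1) J(2)] omodule_mult'[OF J(1) that(2) J(3)]]
    by (simp add: algebra_simps)
  then show ?thesis unfolding qideal_def by auto
qed

lemma ideal_mult_qideal_least:
  assumes J: "omodule J" "emb m * emb m' \<in> J" "emb m * elt D b' 1 \<in> J"
    "elt D b 1 * emb m' \<in> J" "elt D b 1 * elt D b' 1 \<in> J"
  shows "ideal_mult (qideal m b) (qideal m' b') \<subseteq> J"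
proof (rule ideal_mult_least)
  fix x y assume x: "x \<in> qideal m b" and y: "y \<in> qideal m' b'"
  obtain u v where u: "x = emb m * u + elt D b 1 * v" "u \<in> OK" "v \<in> OK"
    using x unfolding qideal_def by blast
  obtain u' v' where u': "y = emb m' * u' + elt D b' 1 * v'" "u' \<in> OK" "v' \<in> OK"
    using y unfolding qideal_def by blast
  have "x * y = (emb m * emb m') * (u * u') + (emb m * elt D b' 1) * (u * v')
      + (elt D b 1 * emb m') * (v * u') + (elt D b 1 * elt D b' 1) * (v * v')"
    unfolding u u' by (simp add: algebra_simps)
  also have "\<dots> \<in> J"
    by (rule omodule_add[OF J(1)] omodule_mult'[OF J(1)] OK_mult J(2-) u(2-) u'(2-))+
  finally show "x * y \<in> J" .
qed (use J in \<open>auto simp: omodule_def\<close>)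

lemma qideal_subset_OK: "qideal m b \<subseteq> OK"
  by (rule qideal_least) (auto intro: omodule_OK)

lemma qideal_unit: "is_unit m \<Longrightarrow> qideal m b = OK"
proof -
  assume "is_unit m"
  then obtain h where h: "m * h = 1" by (metis dvdE)
  have "emb h * emb m \<in> qideal m b"
    using omodule_qideal qideal_gen1 by (intro omodule_mult) auto
  then have "1 \<in> qideal m b" using h by (simp add: mult.commute flip: emb_mult)
  then have "x \<in> qideal m b" if "x \<in> OK" for x
    using omodule_mult[OF omodule_qideal that] by fastforce
  then show ?thesis using qideal_subset_OK by blast
qed

lemma qideal_cong:
  assumes "m dvd b - b'"
  shows "qideal m b = qideal m b'"
proof -
  have "qideal m b \<subseteq> qideal m b'" if d: "m dvd b - b'" for b b'
  proof (rule qideal_least[OF omodule_qideal qideal_gen1])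
    obtain k where "b - b' = m * k" using d by (elim dvdE)
    then have "elt D b 1 = elt D b' 1 + emb m * emb k"
      by (simp add: elt_def algebra_simps flip: emb_add emb_mult)
    then show "elt D b 1 \<in> qideal m b'"
      by (auto intro!: omodule_add[OF omodule_qideal] omodule_mult'[OF omodule_qideal]
          qideal_gen1 qideal_gen2)
  qed
  then show ?thesis using assms by (metis dvd_minus_iff minus_diff_eq subset_antisym)
qed

lemmas elt_arith = elt_mult elt_add elt_diff elt_minus emb_elt[of _ D]

text \<open>The divisibility makes \<open>R m + R (b + s)\<close> closed under multiplication by
  \<open>s\<close>, so coefficients in \<open>R\<close> suffice in place of coefficients in
  \<open>OK\<close>.\<close>

lemma qideal_explicit:
  assumes "m dvd b\<^sup>2 - D" "x \<in> qideal m b"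
  shows "\<exists>u v. x = elt D (m * u + b * v) v"
proof -
  obtain k where k: "b\<^sup>2 - D = m * k" using assms(1) by (elim dvdE)
  obtain u v where uv: "x = emb m * u + elt D b 1 * v" "u \<in> OK" "v \<in> OK"
    using assms(2) unfolding qideal_def by blast
  obtain p q p' q' where pq: "u = elt D p q" "v = elt D p' q'"
    using uv by (auto simp: OK_def)
  have Deq: "D = b * b - m * k" using k by (simp add: power2_eq_square algebra_simps)
  then have "x = elt D (m * (p - b * q - k * q') + b * (m * q + p' + b * q')) (m * q + p' + b * q')"
    unfolding uv pq elt_arith elt_eq_iff by (simp add: Deq algebra_simps)
  then show ?thesis by blast
qed

text \<open>\<open>2 b\<close> will appear as the trace of \<open>b + s\<close> and as the
  difference of \<open>b + s\<close> and \<open>- b + s\<close>; it stays coprime to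
  \<open>m\<close> because 2 is a unit.\<close>

lemma coprime_bezout_two:
  assumes "coprime m b"
  shows "\<exists>r t. r * m + t * (2 * b) = (1::'a poly)"
proof -
  obtain r t where rt: "r * m + t * b = 1" using assms unfolding coprime_iff_bezout by blast
  obtain h where "2 * h = (1::'a poly)" using is_unit_two by (metis dvdE)
  moreover have "(t * h) * (2 * b) = t * b * (2 * h)" by (simp only: mult_ac)
  ultimately have "r * m + (t * h) * (2 * b) = 1"
    using rt by (simp only: mult_1_right)
  then show ?thesis by blast
qed

text \<open>The identity \<open>(b + s)\<^sup>2 = 2 b (b + s) - (b\<^sup>2 - D)\<close> puts all
  products of generators into the right-hand side. Conversely, Bezout for \<open>m1\<close> and
  \<open>2 b\<close> recovers \<open>b + s\<close> from \<open>m1 (b + s)\<close>,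
  \<open>(b + s)\<^sup>2\<close> and \<open>m1 m2\<close>.\<close>

lemma qideal_mult:
  assumes d: "m1 * m2 dvd b\<^sup>2 - D" and cop: "coprime m1 b"
  shows "ideal_mult (qideal m1 b) (qideal m2 b) = qideal (m1 * m2) b"
proof
  obtain k where k: "b\<^sup>2 - D = m1 * m2 * k" using d by (elim dvdE)
  have Deq: "D = b * b - m1 * m2 * k" using k by (simp add: power2_eq_square algebra_simps)
  have sq: "elt D b 1 * elt D b 1 = emb (2 * b) * elt D b 1 - emb k * emb (m1 * m2)"
    unfolding elt_arith elt_eq_iff by (simp add: Deq algebra_simps)
  note om = omodule_qideal
  show "ideal_mult (qideal m1 b) (qideal m2 b) \<subseteq> qideal (m1 * m2) b"
  proof (rule ideal_mult_qideal_least[OF om])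
    show "emb m1 * emb m2 \<in> qideal (m1 * m2) b"
      using qideal_gen1[of "m1 * m2" b] by simp
    show "emb m1 * elt D b 1 \<in> qideal (m1 * m2) b" "elt D b 1 * emb m2 \<in> qideal (m1 * m2) b"
      by (auto intro: omodule_mult[OF om] omodule_mult'[OF om] qideal_gen2)
    show "elt D b 1 * elt D b 1 \<in> qideal (m1 * m2) b"
      unfolding sq by (intro omodule_diff[OF om] omodule_mult[OF om] qideal_gen1 qideal_gen2 OK_emb)
  qed
  define J where "J = ideal_mult (qideal m1 b) (qideal m2 b)"
  have omJ: "omodule J" unfolding J_def by (rule omodule_ideal_mult[OF om])
  have J1: "emb m1 * emb m2 \<in> J" and J2: "emb m1 * elt D b 1 \<in> J"
    and J4: "elt D b 1 * elt D b 1 \<in> J"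
    unfolding J_def by (intro ideal_mult_mem qideal_gen1 qideal_gen2)+
  obtain r t where rt: "r * m1 + t * (2 * b) = 1"
    using coprime_bezout_two[OF cop] by blast
  have "elt D b 1 = emb (r * m1 + t * (2 * b)) * elt D b 1" by (simp add: rt)
  also have "\<dots> = emb r * (emb m1 * elt D b 1)
      + emb t * (elt D b 1 * elt D b 1 + emb k * (emb m1 * emb m2))"
    unfolding sq by (simp add: algebra_simps)
  also have "\<dots> \<in> J"
    by (rule omodule_add[OF omJ] omodule_mult[OF omJ] J1 J2 J4 OK_emb)+
  finally have "elt D b 1 \<in> J" .
  then show "qideal (m1 * m2) b \<subseteq> J"
    using qideal_least[OF omJ] J1 by simp
qed

text \<open>The second factor is the conjugate ideal, since \<open>- b + s\<close> is minus the
  conjugate of \<open>b + s\<close>. All products of generators are multiples of \<open>m\<close>,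
  and Bezout for \<open>m\<close> and \<open>2 b\<close> recovers \<open>m\<close> from
  \<open>m\<^sup>2\<close> and \<open>2 b m\<close>.\<close>

lemma qideal_conj_mult:
  assumes d: "m dvd b\<^sup>2 - D" and cop: "coprime m b"
  shows "ideal_mult (qideal m b) (qideal m (- b)) = scale (emb m) OK"
proof
  obtain k where k: "b\<^sup>2 - D = m * k" using d by (elim dvdE)
  have om: "omodule (scale (emb m) OK)" by (rule omodule_scale[OF omodule_OK])
  have prod: "elt D b 1 * elt D (- b) 1 = emb m * emb (- k)"
    unfolding elt_arith elt_eq_iff using k by (simp add: algebra_simps power2_eq_square)
  show "ideal_mult (qideal m b) (qideal m (- b)) \<subseteq> scale (emb m) OK"
  proof (rule ideal_mult_qideal_least[OF om])
    show "elt D b 1 * emb m \<in> scale (emb m) OK"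
      by (subst mult.commute) (intro imageI elt_in_OK)
    show "elt D b 1 * elt D (- b) 1 \<in> scale (emb m) OK"
      unfolding prod by (intro imageI OK_emb)
  qed (intro imageI OK_emb elt_in_OK)+
  define J where "J = ideal_mult (qideal m b) (qideal m (- b))"
  have omJ: "omodule J" unfolding J_def by (rule omodule_ideal_mult[OF omodule_qideal])
  have J1: "emb m * emb m \<in> J" and J2: "emb m * elt D (- b) 1 \<in> J"
    and J3: "elt D b 1 * emb m \<in> J"
    unfolding J_def by (intro ideal_mult_mem qideal_gen1 qideal_gen2)+
  obtain r t where rt: "r * m + t * (2 * b) = 1"
    using coprime_bezout_two[OF cop] by blast
  have "emb m = emb (r * m + t * (2 * b)) * emb m" by (simp add: rt)
  also have "\<dots> = emb r * (emb m * emb m) + emb t * (elt D b 1 * emb m - emb m * elt D (- b) 1)"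
    by (simp add: elt_def algebra_simps)
  also have "\<dots> \<in> J"
    by (rule J1 J2 J3 OK_emb omodule_add[OF omJ] omodule_diff[OF omJ] omodule_mult[OF omJ])+
  finally have "emb m \<in> J" .
  then show "scale (emb m) OK \<subseteq> J" by (auto intro: omodule_mult'[OF omJ])
qed

text \<open>Because \<open>(b - s) (b + s) = m c\<close>, both sides have the generators
  \<open>m c\<close> and \<open>m (- b + s)\<close> up to sign. On forms this exchanges the outer
  coefficients of \<open>(m, 2 b, c)\<close>.\<close>

lemma qideal_swap:
  assumes "b\<^sup>2 - D = m * c"
  shows "scale (elt D b (- 1)) (qideal m b) = scale (emb m) (qideal c (- b))"
proof
  have 1: "elt D b (- 1) * elt D b 1 = emb m * emb c"
    unfolding elt_arith elt_eq_iff using assms by (simp add: algebra_simps power2_eq_square)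
  have 2: "elt D b (- 1) = - elt D (- b) 1" by (simp add: elt_def)
  note omc = omodule_scale[OF omodule_qideal]
  show "scale (elt D b (- 1)) (qideal m b) \<subseteq> scale (emb m) (qideal c (- b))"
  proof (rule scale_qideal_least[OF omc])
    have "- 1 * elt D (- b) 1 \<in> qideal c (- b)"
      by (intro omodule_mult[OF omodule_qideal] qideal_gen2 OK_minus OK_1)
    then show "elt D b (- 1) * emb m \<in> scale (emb m) (qideal c (- b))"
      by (auto simp: 2 mult.commute intro!: image_eqI[of _ _ "- elt D (- b) 1"])
    show "elt D b (- 1) * elt D b 1 \<in> scale (emb m) (qideal c (- b))"
      unfolding 1 using qideal_gen1 by blast
  qed
  show "scale (emb m) (qideal c (- b)) \<subseteq> scale (elt D b (- 1)) (qideal m b)"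
  proof (rule scale_qideal_least[OF omc])
    show "emb m * emb c \<in> scale (elt D b (- 1)) (qideal m b)"
      unfolding 1[symmetric] using qideal_gen2 by blast
    have "- 1 * emb m \<in> qideal m b"
      by (intro omodule_mult[OF omodule_qideal] qideal_gen1 OK_minus OK_1)
    then show "emb m * elt D (- b) 1 \<in> scale (elt D b (- 1)) (qideal m b)"
      by (auto simp: 2 mult.commute intro!: image_eqI[of _ _ "- emb m"])
  qed
qed

text \<open>Hermite normal form: \<open>e\<close> generates the ideal of all coefficients of the square root of
  \<open>D\<close>, and \<open>e * a\<close> generates the intersection with the polynomials.\<close>
lemma integral_ideal_normal_form:
  assumes om: "omodule J" and sub: "J \<subseteq> OK" and nz: "J \<noteq> {0}"
  shows "\<exists>e a b. e \<noteq> 0 \<and> a \<noteq> 0 \<and> a dvd b\<^sup>2 - D \<and> J = scale (emb e) (qideal a b)"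
proof -
  define Y where "Y = {y. \<exists>x. elt D x y \<in> J}"
  define W where "W = {x. elt D x 0 \<in> J}"
  have mulJ: "elt D (p * x + D * q * y) (p * y + q * x) \<in> J" if "elt D x y \<in> J" for p q x y
    using omodule_mult[OF om elt_in_OK[of p q] that] by (simp add: elt_mult)
  have "\<exists>e\<in>Y. \<forall>y\<in>Y. e dvd y"
  proof (rule euclid_ideal_generator)
    show "0 \<in> Y" using omodule_0[OF om] by (auto simp: Y_def intro!: exI[of _ 0])
    show "x + y \<in> Y" if "x \<in> Y" "y \<in> Y" for x y
      using that omodule_add[OF om] by (auto simp: Y_def) (metis elt_add)
    show "r * x \<in> Y" if "x \<in> Y" for r x
      using that mulJ[where q = 0] by (auto simp: Y_def)
  qed
  then obtain e where e: "e \<in> Y" "\<And>y. y \<in> Y \<Longrightarrow> e dvd y" by blast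
  have "\<exists>e\<in>W. \<forall>y\<in>W. e dvd y"
  proof (rule euclid_ideal_generator)
    show "0 \<in> W" using omodule_0[OF om] by (auto simp: W_def)
    show "x + y \<in> W" if "x \<in> W" "y \<in> W" for x y
      using that omodule_add[OF om, of "elt D x 0" "elt D y 0"] by (auto simp: W_def elt_add)
    show "r * x \<in> W" if "x \<in> W" for r x
      using that mulJ[where q = 0 and y = 0] by (auto simp: W_def)
  qed
  then obtain a0 where a0: "a0 \<in> W" "\<And>y. y \<in> W \<Longrightarrow> a0 dvd y" by blast
  obtain f where f: "elt D f e \<in> J" using e(1) by (auto simp: Y_def)
  obtain z where z: "z \<in> J" "z \<noteq> 0" using nz omodule_0[OF om] by blast
  then obtain x y where xy: "z = elt D x y" using sub by (auto simp: OK_def)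
  \<comment> \<open>Multiplication by \<open>s\<close> turns the first coordinate into the second
    one of another element, so \<open>e\<close> divides both coordinates of every element of
    \<open>J\<close>.\<close>
  have Yx: "x \<in> Y" if "elt D x y \<in> J" for x y
    using mulJ[OF that, of 0 1] by (auto simp: Y_def)
  have "x \<in> Y" "y \<in> Y" using z(1) Yx unfolding xy by (auto simp: Y_def)
  then have e0: "e \<noteq> 0" using e(2) z(2) xy by (metis dvd_0_left elt_0)
  have "e dvd f" using e(2) Yx[OF f] by blast
  then obtain b where b: "f = e * b" by (elim dvdE)
  have "e dvd a0" using e(2) a0(1) Yx by (auto simp: W_def)
  then obtain a where a: "a0 = e * a" by (elim dvdE)
  \<comment> \<open>This is \<open>e (b + s)\<close> times \<open>b - s\<close>.\<close>
  have "elt D (e * (b\<^sup>2 - D)) 0 \<in> J"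
    using mulJ[OF f, of b "- 1"] by (simp add: b algebra_simps power2_eq_square)
  then have adv: "e * a dvd e * (b\<^sup>2 - D)" using a0(2) a unfolding W_def by blast
  then have adv': "a dvd b\<^sup>2 - D" using e0 by simp
  moreover have "b\<^sup>2 - D \<noteq> 0" using poly_norm_neq_0[of b 1] by simp
  ultimately have a_0: "a \<noteq> 0" by auto
  have "J = scale (emb e) (qideal a b)"
  proof
    show "scale (emb e) (qideal a b) \<subseteq> J"
    proof (rule scale_qideal_least[OF om])
      show "emb e * emb a \<in> J" using a0(1) a by (simp add: W_def emb_elt[of _ D] elt_mult)
      show "emb e * elt D b 1 \<in> J" using f by (simp add: emb_mult_elt b)
    qed
    show "J \<subseteq> scale (emb e) (qideal a b)"
    proof
      fix z assume z: "z \<in> J"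
      then obtain x y where xy: "z = elt D x y" using sub by (auto simp: OK_def)
      then have "e dvd y" using z e(2) by (auto simp: Y_def)
      then obtain v where v: "y = e * v" by (elim dvdE)
      \<comment> \<open>Subtracting \<open>v\<close> times \<open>f + e s\<close> removes the second
        coordinate and leaves an element of \<open>W\<close>.\<close>
      have "elt D x y - elt D (v * f) (v * e) \<in> J"
        using z mulJ[OF f, of v 0] by (intro omodule_diff[OF om]) (simp_all add: xy)
      then have "elt D (x - v * f) 0 \<in> J" by (simp add: elt_diff v mult.commute)
      then have "e * a dvd x - v * f" using a0(2) a by (simp add: W_def)
      then obtain u where "x - v * f = e * a * u" by (elim dvdE)
      then have u: "x = e * a * u + v * f" by (simp add: algebra_simps)
      have "z = emb e * (emb a * emb u + elt D b 1 * emb v)"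
        unfolding xy by (simp add: u v b elt_def algebra_simps)
      moreover have "emb a * emb u + elt D b 1 * emb v \<in> qideal a b"
        unfolding qideal_def by blast
      ultimately show "z \<in> scale (emb e) (qideal a b)" by blast
    qed
  qed
  then show ?thesis using e0 a_0 adv' by blast
qed

end

section \<open>The class group\<close>

text \<open>A cyclic subgroup is \<open>generate G {x}\<close> for a generator \<open>x\<close>, and
  its cardinality is the order of \<open>x\<close>. From here on only orders of elements
  matter.\<close>

lemma (in group) has_cyclic_subgroup_iff_ord:
  "has_cyclic_subgroup_of_order G n \<longleftrightarrow> (\<exists>x\<in>carrier G. ord x = n)"
proof
  assume "has_cyclic_subgroup_of_order G n"
  then obtain C where C: "subgroup C G" "cyclic_group (G\<lparr>carrier := C\<rparr>)" "card C = n"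
    unfolding has_cyclic_subgroup_of_order_def by blast
  then obtain x where x: "x \<in> C" "subgroup_generated (G\<lparr>carrier := C\<rparr>) {x} = G\<lparr>carrier := C\<rparr>"
    unfolding cyclic_group_def by auto
  have "C = carrier (subgroup_generated (G\<lparr>carrier := C\<rparr>) {x})" by (simp add: x(2))
  also have "\<dots> = generate (G\<lparr>carrier := C\<rparr>) {x}"
    using x(1) by (simp add: carrier_subgroup_generated)
  also have "\<dots> = generate G {x}"
    using generate_consistent[of "{x}" C] C(1) x(1) by simp
  finally have "ord x = n"
    using C x(1) generate_pow_card[of x] subgroup.mem_carrier by fastforce
  then show "\<exists>x\<in>carrier G. ord x = n"
    using subgroup.mem_carrier[OF C(1) x(1)] by blast
next
  assume "\<exists>x\<in>carrier G. ord x = n"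
  then obtain x where x: "x \<in> carrier G" "ord x = n" by blast
  have "subgroup (generate G {x}) G" using x(1) by (intro generate_is_subgroup) auto
  moreover have "subgroup_generated G {x} = G\<lparr>carrier := generate G {x}\<rparr>"
    using x(1) by (simp add: subgroup_generated_def)
  then have "cyclic_group (G\<lparr>carrier := generate G {x}\<rparr>)"
    using cyclic_group_generated[of x] by simp
  moreover have "card (generate G {x}) = n" using generate_pow_card x by simp
  ultimately show "has_cyclic_subgroup_of_order G n"
    unfolding has_cyclic_subgroup_of_order_def by blast
qed

context real_quadratic_field
begin

section \<open>Representatives of fractional ideals with \<open>m\<close> coprime to
  \<open>b\<close>\<close>

lemma D_not_square_dvd: "Factorial_Ring.irreducible p \<Longrightarrow> \<not> p * p dvd D"
  using squarefreeD[OF squarefree_D, of p]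
  by (auto simp: power2_eq_square Factorial_Ring.irreducible_def)

text \<open>Scaling by the conjugate of \<open>a + b v + v * sqrt D\<close>, an element of the ideal of norm
  \<open>a * m\<close>, realises the substitution of quadratic forms that moves the leading coefficient to the
  value \<open>m\<close> at \<open>(1, v)\<close>.\<close>
lemma qideal_translate:
  fixes a b c v :: "'a poly"
  assumes k: "b\<^sup>2 - D = a * c"
  defines "m \<equiv> a + 2 * b * v + c * v\<^sup>2" and "b' \<equiv> b + c * v"
  shows "b'\<^sup>2 - D = c * m"
    and "scale (elt D (a + b * v) (- v)) (qideal a b) = scale (emb a) (qideal m b')"
proof -
  have Deq: "D = b * b - a * c" using k by (simp add: power2_eq_square algebra_simps)
  show "b'\<^sup>2 - D = c * m"
    by (simp add: b'_def m_def Deq power2_eq_square algebra_simps)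
  define t where "t = elt D (a + b * v) (- v)"
  have 1: "t * elt D b 1 = emb a * elt D b' 1"
    unfolding t_def b'_def elt_arith elt_eq_iff by (simp add: Deq algebra_simps)
  have 2: "t = emb m - emb v * elt D b' 1"
    unfolding t_def b'_def m_def elt_arith elt_eq_iff by (simp add: algebra_simps power2_eq_square)
  have 3: "emb m = t + emb v * elt D b' 1" using 2 by simp
  have 4: "emb a * emb m = t * (emb a + emb v * elt D b 1)"
  proof -
    have "emb a * emb m = emb a * t + emb v * (emb a * elt D b' 1)"
      unfolding 3 by (simp add: algebra_simps)
    also have "\<dots> = t * (emb a + emb v * elt D b 1)"
      unfolding 1[symmetric] by (simp add: algebra_simps)
    finally show ?thesis .
  qed
  note oms = omodule_scale[OF omodule_qideal]
  show "scale t (qideal a b) = scale (emb a) (qideal m b')"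
  proof
    show "scale t (qideal a b) \<subseteq> scale (emb a) (qideal m b')"
    proof (rule scale_qideal_least[OF oms])
      have "t \<in> qideal m b'"
        unfolding 2 by (rule omodule_diff[OF omodule_qideal] omodule_mult[OF omodule_qideal]
            qideal_gen1 qideal_gen2 OK_emb)+
      then show "t * emb a \<in> scale (emb a) (qideal m b')"
        by (subst mult.commute) (rule imageI)
      show "t * elt D b 1 \<in> scale (emb a) (qideal m b')"
        unfolding 1 by (intro imageI qideal_gen2)
    qed
    show "scale (emb a) (qideal m b') \<subseteq> scale t (qideal a b)"
    proof (rule scale_qideal_least[OF oms])
      show "emb a * emb m \<in> scale t (qideal a b)"
        unfolding 4 by (rule imageI) (rule omodule_add[OF omodule_qideal] omodule_mult[OF omodule_qideal]
            qideal_gen1 qideal_gen2 OK_emb)+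
      show "emb a * elt D b' 1 \<in> scale t (qideal a b)"
        unfolding 1[symmetric] by (intro imageI qideal_gen2)
    qed
  qed
qed

lemma square_minus_D_neq_0: "b\<^sup>2 - D \<noteq> 0"
  using poly_norm_neq_0[of b 1] by simp

text \<open>With \<open>v = D div gcd D a\<close> the new leading coefficient is coprime to \<open>D\<close>.\<close>
lemma qideal_coprime_form:
  assumes a: "a \<noteq> 0" and d: "a dvd b\<^sup>2 - D"
  shows "\<exists>x m b'. x \<in> K \<and> x \<noteq> 0 \<and> m \<noteq> 0 \<and> m dvd b'\<^sup>2 - D \<and> coprime m b' \<and>
    qideal a b = scale x (qideal m b')"
proof -
  obtain c where k: "b\<^sup>2 - D = a * c" using d by (elim dvdE)
  have Deq: "D = b * b - a * c" using k by (simp add: power2_eq_square algebra_simps)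
  obtain g r t where g: "g = r * D + t * a" "g dvd D" "g dvd a" using euclid_gcd_exists by blast
  obtain v where v: "D = g * v" using g(2) by (elim dvdE)
  define m where "m = a + 2 * b * v + c * v\<^sup>2"
  define b' where "b' = b + c * v"
  define z where "z = elt D (a + b * v) (- v)"
  have eq: "b'\<^sup>2 - D = c * m" "scale z (qideal a b) = scale (emb a) (qideal m b')"
    using qideal_translate[OF k] unfolding m_def b'_def z_def by blast+
  then have m0: "m \<noteq> 0" using square_minus_D_neq_0[of b'] by auto
  have v0: "v \<noteq> 0" using v D_neq_0 by auto
  have cop: "coprime m b'"
  proof (rule ccontr)
    assume "\<not> coprime m b'"
    then obtain p where p: "Factorial_Ring.irreducible p" "p dvd m" "p dvd b'"
      using euclid_common_prime m0 by blast
    have "D = b' * b' - c * m" using eq(1) by (simp add: power2_eq_square algebra_simps)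
    then have pD: "p dvd D" using p by simp
    \<comment> \<open>Here \<open>p\<close> divides \<open>D = g v\<close>. If \<open>p\<close>
      divides \<open>a\<close>, it divides \<open>b\<close> but not \<open>c\<close>, as
      \<open>p * p\<close> does not divide \<open>D\<close>, and \<open>b' = b + c v\<close> leaves
      \<open>v\<close>. Otherwise \<open>p\<close> cannot divide \<open>g\<close>.\<close>
    have pv: "p dvd v"
    proof (cases "p dvd a")
      case True
      have "p dvd b * b" using Deq pD True by (metis diff_add_cancel dvd_add dvd_mult2)
      then have pb: "p dvd b" using euclid_prime_dvd_mult p(1) by blast
      have "\<not> p dvd c"
      proof
        assume "p dvd c"
        then have "p * p dvd b * b - a * c" using pb True by (intro dvd_diff mult_dvd_mono)
        then show False using Deq D_not_square_dvd p(1) by simp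
      qed
      moreover have "p dvd c * v"
        using p(3) pb by (simp add: b'_def dvd_add_right_iff)
      ultimately show ?thesis using euclid_prime_dvd_mult p(1) by blast
    next
      case False
      then show ?thesis using pD v g(3) euclid_prime_dvd_mult p(1) by (metis dvd_trans)
    qed
    \<comment> \<open>Now \<open>p\<close> divides \<open>a\<close> as well, hence \<open>g\<close>,
      and \<open>p * p\<close> divides \<open>g v = D\<close>.\<close>
    have "m = a + v * (2 * b + c * v)" by (simp add: m_def algebra_simps power2_eq_square)
    then have "p dvd a" using p(2) pv by (metis dvd_add_left_iff dvd_mult2)
    then have "p dvd g" using g(1) pD by simp
    then have "p * p dvd D" using pv unfolding v by (intro mult_dvd_mono)
    then show False using D_not_square_dvd p(1) by blast
  qed
  have z0: "z \<noteq> 0" using v0 by (simp add: z_def elt_eq_0_iff)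
  have "qideal a b = scale (inverse z) (scale z (qideal a b))"
    unfolding scale_scale using z0 by simp
  also have "\<dots> = scale (inverse z * emb a) (qideal m b')"
    unfolding eq(2) scale_scale ..
  finally have "qideal a b = scale (inverse z * emb a) (qideal m b')" .
  moreover have "inverse z * emb a \<in> K"
    by (intro K_mult K_inverse) (auto simp: z_def)
  moreover have "inverse z * emb a \<noteq> 0" using z0 a by simp
  moreover have "m dvd b'\<^sup>2 - D" using eq(1) by simp
  ultimately show ?thesis using m0 cop by blast
qed

lemma fractional_ideal_omodule: "fractional_ideal D I \<Longrightarrow> omodule I"
  unfolding fractional_ideal_def omodule_def quad_integers_eq by blast

text \<open>Clearing denominators gives an integral ideal, to which the normal form and then the
  passage to coprime \<open>m\<close> and \<open>b\<close> apply; \<open>x\<close> collects the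
  scalars.\<close>

lemma fractional_ideal_form:
  assumes "fractional_ideal D I"
  shows "\<exists>x m b. x \<in> K \<and> x \<noteq> 0 \<and> m \<noteq> 0 \<and> m dvd b\<^sup>2 - D \<and> coprime m b \<and>
    I = scale x (qideal m b)"
proof -
  have om: "omodule I" by (rule fractional_ideal_omodule[OF assms])
  obtain d where d: "d \<in> OK" "d \<noteq> 0" "\<forall>x\<in>I. d * x \<in> OK"
    using assms unfolding fractional_ideal_def quad_integers_eq by blast
  have "I \<noteq> {0}" "0 \<in> I" using assms unfolding fractional_ideal_def by blast+
  then obtain y where "y \<in> I" "y \<noteq> 0" by blast
  then have "d * y \<in> scale d I" "d * y \<noteq> 0" using d(2) by auto
  then have nz: "scale d I \<noteq> {0}" by blast
  have "scale d I \<subseteq> OK" using d(3) by blast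
  from integral_ideal_normal_form[OF omodule_scale[OF om] this nz]
  obtain e a b where e: "e \<noteq> 0" "a \<noteq> 0" "a dvd b\<^sup>2 - D" "scale d I = scale (emb e) (qideal a b)"
    by blast
  from qideal_coprime_form[OF e(2,3)] obtain x m b' where
    x: "x \<in> K" "x \<noteq> 0" "m \<noteq> 0" "m dvd b'\<^sup>2 - D" "coprime m b'" "qideal a b = scale x (qideal m b')"
    by blast
  have "I = scale (inverse d) (scale d I)" unfolding scale_scale using d(2) by simp
  also have "\<dots> = scale (inverse d * emb e * x) (qideal m b')"
    unfolding e(4) x(6) scale_scale mult.assoc ..
  finally have "I = scale (inverse d * emb e * x) (qideal m b')" .
  moreover have "inverse d * emb e * x \<in> K"
    using x(1) d(1) OK_subset_K by (intro K_mult K_inverse) auto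
  moreover have "inverse d * emb e * x \<noteq> 0" using x(2) d(2) e(1) by simp
  ultimately show ?thesis using x by blast
qed

section \<open>The group of fractional ideals\<close>

lemma fractional_ideal_integral:
  assumes "omodule I" "I \<subseteq> OK" "I \<noteq> {0}"
  shows "fractional_ideal D I"
  unfolding fractional_ideal_def quad_integers_eq
  using assms OK_subset_K by (auto simp: omodule_def intro!: bexI[of _ 1])

lemma fractional_ideal_qideal:
  assumes "m \<noteq> 0"
  shows "fractional_ideal D (qideal m b)"
  using assms qideal_gen1[of m b]
  by (intro fractional_ideal_integral omodule_qideal qideal_subset_OK) auto

lemma fractional_ideal_OK: "fractional_ideal D OK"
proof (rule fractional_ideal_integral[OF omodule_OK])
  show "OK \<noteq> {0}" using OK_1 by (metis singletonD zero_neq_one)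
qed simp

lemma K_denominator:
  assumes "x \<in> K"
  shows "\<exists>d. d \<noteq> 0 \<and> emb d * x \<in> OK"
proof -
  obtain u v where x: "x = kelt D u v" using assms by (auto simp: quad_field_eq)
  obtain a b where ab: "b \<noteq> 0" "u * to_fract b = to_fract a"
    using fract_reduced by blast
  obtain a' b' where ab': "b' \<noteq> 0" "v * to_fract b' = to_fract a'"
    using fract_reduced by blast
  have "emb (b * b') * x = kelt D (u * to_fract b * to_fract b') (v * to_fract b' * to_fract b)"
    by (simp add: x kelt_def emb_def algebra_simps)
  also have "\<dots> = elt D (a * b') (a' * b)"
    by (simp add: ab ab' elt_kelt)
  finally show ?thesis using ab(1) ab'(1) by (metis elt_in_OK mult_eq_0_iff)
qed

lemma fractional_ideal_mult:
  assumes I: "fractional_ideal D I" and J: "fractional_ideal D J"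
  shows "fractional_ideal D (ideal_mult I J)"
proof -
  have om: "omodule (ideal_mult I J)"
    by (intro omodule_ideal_mult fractional_ideal_omodule J)
  have sub: "ideal_mult I J \<subseteq> K"
    using I J K_emb[of 0]
    by (intro ideal_mult_least) (auto simp: fractional_ideal_def intro: K_add K_mult)
  obtain x where x: "x \<in> I" "x \<noteq> 0" using I unfolding fractional_ideal_def by blast
  obtain y where y: "y \<in> J" "y \<noteq> 0" using J unfolding fractional_ideal_def by blast
  have "x * y \<in> ideal_mult I J" using x y by (intro ideal_mult_mem)
  then have nz: "ideal_mult I J \<noteq> {0}" using x(2) y(2) by (metis mult_eq_0_iff singletonD)
  obtain d where d: "d \<in> OK" "d \<noteq> 0" "\<forall>x\<in>I. d * x \<in> OK"
    using I unfolding fractional_ideal_def quad_integers_eq by blast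
  obtain e where e: "e \<in> OK" "e \<noteq> 0" "\<forall>x\<in>J. e * x \<in> OK"
    using J unfolding fractional_ideal_def quad_integers_eq by blast
  have "ideal_mult I J \<subseteq> {z. d * e * z \<in> OK}"
  proof (rule ideal_mult_least)
    fix u v assume "u \<in> I" "v \<in> J"
    then have "(d * u) * (e * v) \<in> OK" using OK_mult[OF bspec[OF d(3)] bspec[OF e(3)]] by blast
    then show "u * v \<in> {z. d * e * z \<in> OK}" by (simp add: mult_ac)
  qed (auto simp: distrib_left intro: OK_add)
  then show ?thesis
    using om sub nz d e OK_mult[OF d(1) e(1)]
    unfolding fractional_ideal_def quad_integers_eq omodule_def
    by (intro conjI bexI[of _ "d * e"]) auto
qed

lemma fractional_ideal_scale:
  assumes I: "fractional_ideal D I" and x: "x \<in> K" "x \<noteq> 0"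
  shows "fractional_ideal D (scale x I)"
proof -
  have om: "omodule (scale x I)" by (intro omodule_scale fractional_ideal_omodule I)
  obtain d where d: "d \<in> OK" "d \<noteq> 0" "\<forall>x\<in>I. d * x \<in> OK"
    using I unfolding fractional_ideal_def quad_integers_eq by blast
  obtain e where e: "e \<noteq> 0" "emb e * x \<in> OK" using K_denominator[OF x(1)] by blast
  obtain y where y: "y \<in> I" "y \<noteq> 0" using I unfolding fractional_ideal_def by blast
  then have "x * y \<in> scale x I" "x * y \<noteq> 0" using x by auto
  then have nz: "scale x I \<noteq> {0}" by blast
  have "d * emb e * (x * u) \<in> OK" if "u \<in> I" for u
  proof -
    have "(d * u) * (emb e * x) \<in> OK" by (rule OK_mult[OF bspec[OF d(3) that] e(2)])
    then show ?thesis by (simp add: mult_ac)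
  qed
  moreover have "d * emb e \<in> OK" "d * emb e \<noteq> 0" using d e OK_mult by auto
  moreover have "scale x I \<subseteq> K"
    using I x(1) K_mult unfolding fractional_ideal_def by auto
  ultimately show ?thesis
    using om nz unfolding fractional_ideal_def quad_integers_eq omodule_def by blast
qed

lemma ideal_group_simps:
  "carrier (ideal_group D) = {I. fractional_ideal D I}"
  "I \<otimes>\<^bsub>ideal_group D\<^esub> J = ideal_mult I J"
  "\<one>\<^bsub>ideal_group D\<^esub> = OK"
  by (simp_all add: ideal_group_def quad_integers_eq)

text \<open>The inverse of \<open>x (m, b + s)\<close> is the conjugate ideal
  \<open>(m, - b + s)\<close> divided by \<open>x m\<close>.\<close>

lemma fractional_ideal_inverse:
  assumes "fractional_ideal D I"
  shows "\<exists>J. fractional_ideal D J \<and> ideal_mult J I = OK"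
proof -
  from fractional_ideal_form[OF assms] obtain x m b where
    x: "x \<in> K" "x \<noteq> 0" "m \<noteq> 0" "m dvd b\<^sup>2 - D" "coprime m b" "I = scale x (qideal m b)" by blast
  define J where "J = scale (inverse (x * emb m)) (qideal m (- b))"
  have "ideal_mult J I = ideal_mult I J" by (rule ideal_mult_commute)
  also have "\<dots> = scale (x * inverse (x * emb m)) (scale (emb m) OK)"
    unfolding J_def x(6) ideal_mult_scale qideal_conj_mult[OF x(4,5)] ..
  also have "\<dots> = OK"
  proof -
    have "x * inverse (x * emb m) * emb m = x * emb m * inverse (x * emb m)"
      by (simp only: mult_ac)
    also have "\<dots> = 1" using x(2,3) by (intro right_inverse) simp
    finally show ?thesis unfolding scale_scale by simp
  qed
  finally have "ideal_mult J I = OK" .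
  moreover have "fractional_ideal D J"
    unfolding J_def using x
    by (intro fractional_ideal_scale fractional_ideal_qideal K_inverse K_mult) auto
  ultimately show ?thesis by blast
qed

lemma comm_group_ideal_group: "comm_group (ideal_group D)"
proof (rule comm_groupI; unfold ideal_group_simps mem_Collect_eq)
  show "ideal_mult (ideal_mult x y) z = ideal_mult x (ideal_mult y z)" for x y z
    by (rule ideal_mult_assoc)
  show "ideal_mult x y = ideal_mult y x" for x y
    by (rule ideal_mult_commute)
  show "ideal_mult OK x = x" if "fractional_ideal D x" for x
    using that by (intro ideal_mult_OK fractional_ideal_omodule)
  show "\<exists>y\<in>Collect (fractional_ideal D). ideal_mult y x = OK" if "fractional_ideal D x" for x
    using fractional_ideal_inverse[OF that] by blast
qed (fact fractional_ideal_mult fractional_ideal_OK)+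

sublocale ig: comm_group "ideal_group D"
  by (rule comm_group_ideal_group)

section \<open>Principal ideals and the class group\<close>

lemma principal_ideals_eq: "principal_ideals D = {scale x OK | x. x \<in> K \<and> x \<noteq> 0}"
  by (simp add: principal_ideals_def quad_integers_eq)

lemma scale_OK_mult: "ideal_mult (scale x OK) (scale y OK) = scale (x * y) OK"
  by (simp add: ideal_mult_scale ideal_mult_OK[OF omodule_OK])

lemma subgroup_principal_ideals: "subgroup (principal_ideals D) (ideal_group D)"
proof (rule ig.subgroupI)
  show "principal_ideals D \<subseteq> carrier (ideal_group D)"
    by (auto simp: principal_ideals_eq ideal_group_simps intro: fractional_ideal_scale fractional_ideal_OK)
  show "principal_ideals D \<noteq> {}"
    using K_emb[of 1] by (auto simp: principal_ideals_eq intro!: exI[of _ 1])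
next
  fix I assume "I \<in> principal_ideals D"
  then obtain x where x: "x \<in> K" "x \<noteq> 0" "I = scale x OK" by (auto simp: principal_ideals_eq)
  have "inv\<^bsub>ideal_group D\<^esub> I = scale (inverse x) OK"
    unfolding x(3) using x(1,2)
    by (intro ig.inv_equality)
      (auto simp: ideal_group_simps scale_OK_mult simp del: image_ident
        intro!: fractional_ideal_scale fractional_ideal_OK K_inverse)
  then show "inv\<^bsub>ideal_group D\<^esub> I \<in> principal_ideals D"
    using x K_inverse by (auto simp: principal_ideals_eq)
next
  fix I J assume "I \<in> principal_ideals D" "J \<in> principal_ideals D"
  then obtain x y where "x \<in> K" "x \<noteq> 0" "I = scale x OK" "y \<in> K" "y \<noteq> 0" "J = scale y OK"
    by (auto simp: principal_ideals_eq)
  then show "I \<otimes>\<^bsub>ideal_group D\<^esub> J \<in> principal_ideals D"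
    using K_mult[of x y] scale_OK_mult[of x y]
    by (auto simp: ideal_group_simps principal_ideals_eq intro!: exI[of _ "x * y"])
qed

sublocale pri: normal "principal_ideals D" "ideal_group D"
  by (rule ig.subgroup_imp_normal[OF subgroup_principal_ideals])

sublocale cg: comm_group "class_group D"
  unfolding class_group_def by (rule ig.abelian_FactGroup[OF subgroup_principal_ideals])

definition cls :: "'a poly fract alg_closure set \<Rightarrow> 'a poly fract alg_closure set set" where
  "cls I = principal_ideals D #>\<^bsub>ideal_group D\<^esub> I"

lemma cls_carrier: "carrier (class_group D) = cls ` {I. fractional_ideal D I}"
  by (simp add: class_group_def carrier_FactGroup cls_def[abs_def] ideal_group_simps)

lemma cls_closed: "fractional_ideal D I \<Longrightarrow> cls I \<in> carrier (class_group D)"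
  by (simp add: cls_carrier)

lemma cls_mult:
  assumes "fractional_ideal D I" "fractional_ideal D J"
  shows "cls (ideal_mult I J) = cls I \<otimes>\<^bsub>class_group D\<^esub> cls J"
  using pri.rcos_sum[of I J] assms
  by (simp add: class_group_def cls_def ideal_group_simps)

lemma cls_eq_one_iff:
  assumes "fractional_ideal D I"
  shows "cls I = \<one>\<^bsub>class_group D\<^esub> \<longleftrightarrow> (\<exists>x\<in>K. x \<noteq> 0 \<and> I = scale x OK)"
proof -
  have "cls I = \<one>\<^bsub>class_group D\<^esub> \<longleftrightarrow> I \<in> principal_ideals D"
    using assms ig.coset_join1[of "principal_ideals D" I] ig.coset_join2[of I "principal_ideals D"]
      subgroup_principal_ideals
    unfolding class_group_def cls_def by (auto simp: ideal_group_simps pri.subset)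
  then show ?thesis by (auto simp: principal_ideals_eq)
qed

lemma cls_scale:
  assumes "fractional_ideal D I" "x \<in> K" "x \<noteq> 0"
  shows "cls (scale x I) = cls I"
proof -
  have f: "fractional_ideal D (scale x OK)"
    using assms by (intro fractional_ideal_scale fractional_ideal_OK)
  then have "cls (scale x OK) = \<one>\<^bsub>class_group D\<^esub>" using assms cls_eq_one_iff by blast
  then have "cls (ideal_mult (scale x OK) I) = cls I"
    using cls_mult[OF f assms(1)] cls_closed[OF assms(1)] by simp
  then show ?thesis using ideal_mult_principal[OF fractional_ideal_omodule[OF assms(1)]] by simp
qed

section \<open>Classes of the ideals \<open>(m, b + s)\<close> and finiteness of the class
  group\<close>

definition qclass :: "'a poly \<Rightarrow> 'a poly \<Rightarrow> 'a poly fract alg_closure set set" where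
  "qclass m b = cls (qideal m b)"

lemma qclass_closed [simp, intro]: "m \<noteq> 0 \<Longrightarrow> qclass m b \<in> carrier (class_group D)"
  unfolding qclass_def by (intro cls_closed fractional_ideal_qideal)

lemma qclass_cong: "m dvd b - b' \<Longrightarrow> qclass m b = qclass m b'"
  unfolding qclass_def using qideal_cong by simp

lemma qclass_unit:
  assumes "is_unit m"
  shows "qclass m b = \<one>\<^bsub>class_group D\<^esub>"
  unfolding qclass_def qideal_unit[OF assms] cls_eq_one_iff[OF fractional_ideal_OK]
  using K_emb[of 1] by (intro bexI[of _ 1]) auto

lemma dvd_square_minus_D_neq_0: "m dvd b\<^sup>2 - D \<Longrightarrow> m \<noteq> 0"
  using square_minus_D_neq_0 by auto

lemma qclass_mult:
  assumes "m1 * m2 dvd b\<^sup>2 - D" "coprime m1 b"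
  shows "qclass (m1 * m2) b = qclass m1 b \<otimes>\<^bsub>class_group D\<^esub> qclass m2 b"
  using cls_mult[OF fractional_ideal_qideal fractional_ideal_qideal, of m1 m2 b b]
    qideal_mult[OF assms] dvd_square_minus_D_neq_0[OF assms(1)]
  by (simp add: qclass_def)

text \<open>Iterates \<open>qclass_mult\<close> with one fixed \<open>b\<close>, which therefore has
  to be a root of \<open>D\<close> modulo the full power \<open>m ^ k\<close>.\<close>

lemma qclass_power:
  assumes "m ^ k dvd b\<^sup>2 - D" "coprime m b"
  shows "qclass (m ^ k) b = qclass m b [^]\<^bsub>class_group D\<^esub> k"
  using assms(1)
proof (induction k)
  case 0
  then show ?case by (simp add: qclass_unit)
next
  case (Suc k)
  then have d: "m ^ k dvd b\<^sup>2 - D" by (metis dvd_mult_right power_Suc)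
  have m0: "m \<noteq> 0" using dvd_square_minus_D_neq_0[OF Suc.prems] by auto
  have "qclass (m ^ Suc k) b = qclass m b \<otimes>\<^bsub>class_group D\<^esub> qclass (m ^ k) b"
    using qclass_mult[of m "m ^ k" b] Suc.prems assms(2) by simp
  also have "\<dots> = qclass m b [^]\<^bsub>class_group D\<^esub> Suc k"
    using Suc.IH[OF d] m0 cg.m_comm[of "qclass m b" "qclass m b [^]\<^bsub>class_group D\<^esub> k"] by simp
  finally show ?case .
qed

lemma qclass_uminus:
  assumes "m dvd b\<^sup>2 - D" "coprime m b"
  shows "qclass m (- b) = inv\<^bsub>class_group D\<^esub> (qclass m b)"
proof -
  have m0: "m \<noteq> 0" using dvd_square_minus_D_neq_0[OF assms(1)] .
  have "qclass m b \<otimes>\<^bsub>class_group D\<^esub> qclass m (- b) = cls (scale (emb m) OK)"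
    using cls_mult[OF fractional_ideal_qideal fractional_ideal_qideal, of m m b "- b"] m0
      qideal_conj_mult[OF assms] by (simp add: qclass_def)
  also have "\<dots> = \<one>\<^bsub>class_group D\<^esub>"
    using m0 by (subst cls_eq_one_iff)
      (auto intro!: fractional_ideal_scale fractional_ideal_OK bexI[of _ "emb m"])
  finally show ?thesis
    using m0 by (metis cg.inv_equality cg.m_comm qclass_closed)
qed

lemma class_group_form:
  assumes "g \<in> carrier (class_group D)"
  shows "\<exists>m b. m dvd b\<^sup>2 - D \<and> coprime m b \<and> g = qclass m b"
proof -
  obtain I where I: "fractional_ideal D I" "g = cls I" using assms by (auto simp: cls_carrier)
  from fractional_ideal_form[OF I(1)] obtain x m b where
    x: "x \<in> K" "x \<noteq> 0" "m \<noteq> 0" "m dvd b\<^sup>2 - D" "coprime m b" "I = scale x (qideal m b)" by blast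
  then have "g = qclass m b"
    using cls_scale[OF fractional_ideal_qideal[OF x(3)] x(1,2)] I(2) by (simp add: qclass_def)
  then show ?thesis using x by blast
qed

lemma qclass_swap:
  assumes "b\<^sup>2 - D = m * c"
  shows "qclass m b = qclass c (- b)"
proof -
  have "m \<noteq> 0" "c \<noteq> 0" using square_minus_D_neq_0[of b] assms by auto
  moreover have "elt D b (- 1) \<noteq> 0" by (simp add: elt_eq_0_iff)
  ultimately show ?thesis
    unfolding qclass_def using qideal_swap[OF assms] cls_scale fractional_ideal_qideal
    by (metis K_elt K_emb emb_eq_0_iff)
qed

text \<open>Gauss reduction of the form \<open>(m, 2 b, c)\<close>, \<open>b\<^sup>2 - m c = D\<close>.\<close>
lemma qclass_reduced:
  assumes "m dvd b\<^sup>2 - D"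
  shows "\<exists>m' b'. Polynomial.degree m' \<le> Polynomial.degree D \<and>
    Polynomial.degree b' \<le> Polynomial.degree D \<and> m' \<noteq> 0 \<and> qclass m b = qclass m' b'"
  using assms
proof (induction "Polynomial.degree m" arbitrary: m b rule: less_induct)
  case less
  have m0: "m \<noteq> 0" using dvd_square_minus_D_neq_0[OF less.prems] .
  define b' where "b' = b mod m"
  have "m dvd b - b'" unfolding b'_def by (simp add: minus_mod_eq_mult_div)
  then have eq: "qclass m b = qclass m b'" by (rule qclass_cong)
  have "b'\<^sup>2 - D = (b\<^sup>2 - D) - (b - b') * (b + b')" by (simp add: algebra_simps power2_eq_square)
  moreover have "m dvd (b - b') * (b + b')" using \<open>m dvd b - b'\<close> by (rule dvd_mult2)
  ultimately have d: "m dvd b'\<^sup>2 - D" using less.prems by (simp only: dvd_diff)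
  have deg: "b' = 0 \<or> Polynomial.degree b' < Polynomial.degree m"
    unfolding b'_def using degree_mod_less[OF m0] by blast
  show ?case
  proof (cases "Polynomial.degree m \<le> Polynomial.degree D")
    case True
    then have "Polynomial.degree b' \<le> Polynomial.degree D" using deg by auto
    then show ?thesis using True eq m0 by blast
  next
    case False
    obtain c where c: "b'\<^sup>2 - D = m * c" using d by (elim dvdE)
    then have c0: "c \<noteq> 0" using square_minus_D_neq_0[of b'] by auto
    \<comment> \<open>\<open>b'\<close> and \<open>D\<close> have smaller degree than
      \<open>m\<close>, so \<open>m c\<close> has degree below twice that of \<open>m\<close>;
      swapping then replaces \<open>m\<close> by \<open>c\<close> of smaller degree.\<close>
    have "Polynomial.degree m + Polynomial.degree c = Polynomial.degree (b'\<^sup>2 - D)"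
      using m0 c0 by (simp add: c degree_mult_eq)
    also have "\<dots> \<le> max (Polynomial.degree (b'\<^sup>2)) (Polynomial.degree D)"
      by (rule degree_diff_le_max)
    also have "\<dots> < 2 * Polynomial.degree m"
      using deg False degree_power_le[of b' 2] by auto
    finally have "Polynomial.degree c < Polynomial.degree m" by simp
    moreover have "c dvd (- b')\<^sup>2 - D" using c by simp
    ultimately show ?thesis using less.hyps qclass_swap[OF c] eq by metis
  qed
qed

text \<open>Reduced pairs have bounded degree, and over a finite field there are only finitely many.
  Hence all orders of classes are positive.\<close>

lemma finite_class_group: "finite (carrier (class_group D))"
proof (rule finite_subset)
  let ?S = "{p :: 'a poly. Polynomial.degree p \<le> Polynomial.degree D}"
  show "carrier (class_group D) \<subseteq> case_prod qclass ` (?S \<times> ?S)"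
  proof
    fix g assume "g \<in> carrier (class_group D)"
    then obtain m b where "m dvd b\<^sup>2 - D" "g = qclass m b" using class_group_form by blast
    then obtain m' b' where "g = qclass m' b'" "m' \<in> ?S" "b' \<in> ?S"
      using qclass_reduced[of m b] by auto
    then show "g \<in> case_prod qclass ` (?S \<times> ?S)"
      by (intro image_eqI[of _ _ "(m', b')"]) auto
  qed
qed (intro finite_imageI finite_cartesian_product finite_degree_le)

end

section \<open>Norm equations and orders of classes\<close>

context real_quadratic_field
begin

text \<open>Modulo \<open>m\<close>, \<open>D\<close> is the square of \<open>b\<close>. As
  \<open>coprime m D\<close> does not mention \<open>b\<close>, coprimality passes from one root of
  \<open>D\<close> modulo \<open>m\<close> to every other.\<close>

lemma coprime_root_iff_coprime_D:
  assumes "m dvd b\<^sup>2 - D"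
  shows "coprime m b \<longleftrightarrow> coprime m D"
proof -
  obtain k where "b\<^sup>2 - D = m * k" using assms by (elim dvdE)
  then have Deq: "D = b\<^sup>2 + m * (- k)" by (simp add: algebra_simps)
  have "coprime m D \<longleftrightarrow> coprime m (b\<^sup>2)"
    unfolding Deq by (rule coprime_add_mult_iff)
  also have "\<dots> \<longleftrightarrow> coprime m b"
  proof
    assume "coprime m (b\<^sup>2)"
    then show "coprime m b" by (metis coprime_commute coprime_dvd_left_mono dvd_triv_left power2_eq_square)
  next
    assume "coprime m b"
    then show "coprime m (b\<^sup>2)" by (metis coprime_commute euclid_coprime_power)
  qed
  finally show ?thesis ..
qed

text \<open>The pairs \<open>(m, b + s)\<close> and \<open>(g, g s)\<close>, \<open>s\<close> the square root of \<open>D\<close> and \<open>g = x + y s\<close> a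
  generator, are bases of the same module; comparing determinants gives the norm equation.\<close>
lemma qclass_one_imp_solution:
  assumes d: "m dvd b\<^sup>2 - D" and one: "qclass m b = \<one>\<^bsub>class_group D\<^esub>"
  shows "\<exists>c x y. c \<noteq> 0 \<and> coprime x y \<and> x\<^sup>2 - D * y\<^sup>2 = Polynomial.smult c m"
proof -
  have m0: "m \<noteq> 0" by (rule dvd_square_minus_D_neq_0[OF d])
  obtain g where g: "g \<in> K" "g \<noteq> 0" "qideal m b = scale g OK"
    using one cls_eq_one_iff[OF fractional_ideal_qideal[OF m0]] unfolding qclass_def by blast
  have "g * 1 \<in> scale g OK" using OK_1 by (rule imageI)
  then have gq: "g \<in> qideal m b" using g(3) by simp
  then obtain u y where uy: "g = elt D (m * u + b * y) y" using qideal_explicit[OF d] by blast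
  define x where "x = m * u + b * y"
  have gxy: "g = elt D x y" by (simp add: uy x_def)
  have "emb m \<in> scale g OK" "elt D b 1 \<in> scale g OK"
    unfolding g(3)[symmetric] by (rule qideal_gen1 qideal_gen2)+
  then obtain p q p' q' where pq: "emb m = g * elt D p q" and pq': "elt D b 1 = g * elt D p' q'"
    by (auto simp: OK_def)
  have m: "m = x * p + D * y * q" "0 = x * q + y * p"
    using pq unfolding gxy elt_arith elt_eq_iff by blast+
  have o: "b = x * p' + D * y * q'" "1 = x * q' + y * p'"
    using pq' unfolding gxy elt_arith elt_eq_iff by blast+
  define N where "N = x\<^sup>2 - D * y\<^sup>2"
  have "m = m * 1 - 0 * b" by simp
  also have "\<dots> = (x * p + D * y * q) * (x * q' + y * p') - (x * q + y * p) * (x * p' + D * y * q')"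
    using m o by metis
  also have "\<dots> = N * (p * q' - q * p')"
    by (simp add: N_def algebra_simps power2_eq_square)
  finally have mN: "m = N * (p * q' - q * p')" .
  \<comment> \<open>The norm is in turn a multiple of \<open>m\<close>, so the determinant
    \<open>p * q' - q * p'\<close> is a unit and \<open>N\<close> is a constant times
    \<open>m\<close>.\<close>
  have "N = m * (m * u * u + 2 * u * b * y) + y\<^sup>2 * (b\<^sup>2 - D)"
    by (simp add: N_def x_def algebra_simps power2_eq_square)
  also have "m dvd \<dots>" using d by simp
  finally obtain h where h: "N = m * h" by (elim dvdE)
  have "m * (h * (p * q' - q * p')) = m * 1" using mN h by (simp add: mult.assoc)
  then have "h * (p * q' - q * p') = 1" using m0 mult_left_cancel by blast
  then have "is_unit h" by (metis dvd_triv_left)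
  then obtain c where c: "h = [:c:]" "c \<noteq> 0"
    by (auto simp: is_unit_poly_iff dvd_field_iff)
  \<comment> \<open>The second coordinate of \<open>b + s = g (p' + q' s)\<close> is a Bezout
    relation for \<open>x\<close> and \<open>y\<close>.\<close>
  have "coprime x y"
    unfolding coprime_iff_bezout using o(2) by (metis mult.commute)
  moreover have "x\<^sup>2 - D * y\<^sup>2 = Polynomial.smult c m"
    using h c by (simp add: N_def mult.commute)
  ultimately show ?thesis using c(2) by blast
qed

text \<open>A common prime of \<open>m\<close> and \<open>y\<close> would divide \<open>x\<close>,
  so \<open>y\<close> is invertible modulo \<open>m\<close> and \<open>t = x / y\<close> is a root
  of \<open>D\<close> modulo \<open>m\<close>. The ideal \<open>(m, t + s)\<close> is then generated
  by \<open>x + y s\<close>.\<close>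

lemma solution_imp_qclass_one:
  assumes xy: "coprime x y" and eq: "x\<^sup>2 - D * y\<^sup>2 = Polynomial.smult c m" and c: "c \<noteq> 0"
  shows "\<exists>t. m dvd t\<^sup>2 - D \<and> qclass m t = \<one>\<^bsub>class_group D\<^esub>"
proof -
  have "x \<noteq> 0 \<or> y \<noteq> 0" using xy by auto
  then have m0: "m \<noteq> 0" using poly_norm_neq_0 eq by fastforce
  have mN: "m dvd x\<^sup>2 - D * y\<^sup>2" unfolding eq by (simp add: dvd_smult)
  have "coprime m y"
  proof (rule ccontr)
    assume "\<not> coprime m y"
    then obtain p where p: "Factorial_Ring.irreducible p" "p dvd m" "p dvd y"
      using euclid_common_prime m0 by blast
    have "p dvd x\<^sup>2 - D * y\<^sup>2" using mN p(2) by (rule dvd_trans[rotated])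
    moreover have "p dvd D * y\<^sup>2" using p(3) by (simp add: power2_eq_square)
    ultimately have "p dvd x\<^sup>2" by (metis diff_add_cancel dvd_add)
    then have "p dvd x" using euclid_prime_dvd_power p(1) by blast
    then have "is_unit p" using xy p(3) coprime_common_divisor by blast
    then show False using p(1) unfolding Factorial_Ring.irreducible_def by blast
  qed
  then obtain k r where kr: "k * m + r * y = 1" unfolding coprime_iff_bezout by blast
  define t where "t = r * x"
  have ty: "x - t * y = m * (k * x)"
  proof -
    have "x - t * y = (k * m + r * y) * x - r * x * y" by (simp add: kr t_def)
    then show ?thesis by (simp add: algebra_simps)
  qed
  have "m dvd (x - t * y) * (x + t * y)" unfolding ty by (simp add: mult.assoc)
  then have "m dvd (x\<^sup>2 - D * y\<^sup>2) - (x - t * y) * (x + t * y)" using mN by (rule dvd_diff[rotated])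
  also have "(x\<^sup>2 - D * y\<^sup>2) - (x - t * y) * (x + t * y) = y\<^sup>2 * (t\<^sup>2 - D)"
    by (simp add: algebra_simps power2_eq_square)
  finally have "m dvd y\<^sup>2 * (t\<^sup>2 - D)" .
  moreover have "coprime m (y\<^sup>2)"
    using \<open>coprime m y\<close> by (metis coprime_commute euclid_coprime_power)
  ultimately have d: "m dvd t\<^sup>2 - D" by (rule euclid_coprime_dvd_mult[rotated])
  define g where "g = elt D x y"
  note omO = omodule_scale[OF omodule_OK]
  have g0: "g \<noteq> 0" using \<open>x \<noteq> 0 \<or> y \<noteq> 0\<close> by (auto simp: g_def elt_eq_0_iff)
  have "qideal m t = scale g OK"
  proof
    have "emb m = g * (elt D x (- y) * emb [:inverse c:])"
    proof -
      have "m = (x\<^sup>2 - D * y\<^sup>2) * [:inverse c:]" using c by (simp add: eq)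
      then have "emb m = emb (x\<^sup>2 - D * y\<^sup>2) * emb [:inverse c:]" by (metis emb_mult)
      also have "emb (x\<^sup>2 - D * y\<^sup>2) = g * elt D x (- y)"
        unfolding g_def elt_arith elt_eq_iff by (simp add: power2_eq_square mult.assoc)
      finally show ?thesis by (simp only: mult.assoc)
    qed
    then have mem1: "emb m \<in> scale g OK" by (auto intro!: OK_mult)
    have "g * 1 \<in> scale g OK" using OK_1 by (rule imageI)
    then have mem2: "g \<in> scale g OK" by simp
    \<comment> \<open>Splits \<open>t + s\<close> along the Bezout relation:
      \<open>y (t + s)\<close> differs from \<open>g\<close> by \<open>x - t y\<close>, a multiple
      of \<open>m\<close>, and \<open>m\<close> is a multiple of \<open>g\<close> because the norm
      of \<open>g\<close> is \<open>c m\<close>.\<close>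
    have "elt D t 1 = emb (k * m + r * y) * elt D t 1" by (simp add: kr)
    also have "\<dots> = emb m * (emb k * elt D t 1) + emb r * (emb y * elt D t 1)"
      by (simp add: algebra_simps)
    also have "emb y * elt D t 1 = g - emb (x - t * y)"
      unfolding g_def elt_arith elt_eq_iff by (simp add: mult.commute)
    also have "emb (x - t * y) = emb m * emb (k * x)" unfolding ty emb_mult ..
    also have "emb m * (emb k * elt D t 1) + emb r * (g - emb m * emb (k * x)) \<in> scale g OK"
      by (rule mem2 OK_emb elt_in_OK omodule_add[OF omO] omodule_diff[OF omO]
          omodule_mult'[OF omO, OF _ mem1] omodule_mult[OF omO] OK_mult)+
    finally show "qideal m t \<subseteq> scale g OK" by (rule qideal_least[OF omO mem1])
    have "g = emb y * elt D t 1 + emb (k * x) * emb m"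
    proof -
      have "g = emb y * elt D t 1 + emb (x - t * y)"
        unfolding g_def elt_arith elt_eq_iff by (simp add: mult.commute)
      then show ?thesis unfolding ty by (simp add: mult_ac)
    qed
    also have "\<dots> \<in> qideal m t"
      by (rule OK_emb qideal_gen1 qideal_gen2 omodule_add[OF omodule_qideal]
          omodule_mult[OF omodule_qideal])+
    finally show "scale g OK \<subseteq> qideal m t" by (auto intro: omodule_mult'[OF omodule_qideal])
  qed
  then have "qclass m t = \<one>\<^bsub>class_group D\<^esub>"
    unfolding qclass_def cls_eq_one_iff[OF fractional_ideal_qideal[OF m0]]
    using g0 by (intro bexI[of _ g]) (auto simp: g_def)
  then show ?thesis using d by blast
qed

text \<open>A prime \<open>p\<close> dividing \<open>Z\<close> and \<open>D\<close> divides
  \<open>x\<close> and hence not \<open>y\<close>. As \<open>n \<ge> 2\<close>,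
  \<open>p\<^sup>2\<close> divides the norm, so it divides \<open>D y\<^sup>2\<close> and thus the
  square-free \<open>D\<close>.\<close>

lemma solution_coprime_D:
  assumes xy: "coprime x y" and eq: "x\<^sup>2 - D * y\<^sup>2 = Polynomial.smult c (Z ^ n)"
    and n: "n \<ge> 2" and Z: "Z \<noteq> 0"
  shows "coprime Z D"
proof (rule ccontr)
  assume "\<not> coprime Z D"
  then obtain p where p: "Factorial_Ring.irreducible p" "p dvd Z" "p dvd D"
    using euclid_common_prime Z by blast
  have "p\<^sup>2 dvd Z\<^sup>2" using p(2) by (rule dvd_power_same)
  also have "Z\<^sup>2 dvd Z ^ n" using n by (rule le_imp_power_dvd)
  finally have N: "p\<^sup>2 dvd x\<^sup>2 - D * y\<^sup>2" unfolding eq by (rule dvd_smult)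
  then have "p dvd x\<^sup>2 - D * y\<^sup>2" by (metis dvd_mult_left power2_eq_square)
  then have "p dvd x\<^sup>2" using p(3) by (metis diff_add_cancel dvd_add dvd_mult2)
  then have px: "p dvd x" using euclid_prime_dvd_power p(1) by blast
  then have "p\<^sup>2 dvd x\<^sup>2" by (rule dvd_power_same)
  then have "p\<^sup>2 dvd x\<^sup>2 - (x\<^sup>2 - D * y\<^sup>2)" using N by (rule dvd_diff)
  then have Dy: "p\<^sup>2 dvd y\<^sup>2 * D" by (simp add: mult.commute)
  have "\<not> is_unit p" using p(1) unfolding Factorial_Ring.irreducible_def by blast
  then have "\<not> p dvd y" using xy px coprime_common_divisor by blast
  then have "coprime p y" using euclid_irreducible_prime p(1) by blast
  then have "coprime (p\<^sup>2) (y\<^sup>2)" by (metis coprime_commute euclid_coprime_power)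
  then have "p\<^sup>2 dvd D" using Dy by (rule euclid_coprime_dvd_mult)
  then show False using D_not_square_dvd[OF p(1)] by (simp add: power2_eq_square)
qed

text \<open>A root \<open>t\<close> modulo \<open>Z ^ n\<close> is also one modulo
  \<open>Z ^ j\<close> for \<open>j \<le> n\<close>, so the powers of the class of
  \<open>(Z, t + s)\<close> up to \<open>n\<close> are the classes of \<open>(Z ^ j, t + s)\<close>.
  The order divides \<open>n\<close>, and a smaller one would give an excluded solution.\<close>

lemma solution_imp_class_of_order:
  assumes n: "n \<ge> 2" and Z: "Z \<noteq> 0"
    and xy: "c \<noteq> 0" "coprime x y" "x\<^sup>2 - D * y\<^sup>2 = Polynomial.smult c (Z ^ n)"
    and none: "\<And>c' j x y. c' \<noteq> 0 \<Longrightarrow> 1 \<le> j \<Longrightarrow> j dvd n \<Longrightarrow> j \<noteq> n \<Longrightarrow> coprime x y \<Longrightarrow>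
      x\<^sup>2 - D * y\<^sup>2 \<noteq> Polynomial.smult c' (Z ^ j)"
  shows "\<exists>g\<in>carrier (class_group D). cg.ord g = n"
proof -
  have ZD: "coprime Z D" by (rule solution_coprime_D[OF xy(2,3) n Z])
  obtain t where t: "Z ^ n dvd t\<^sup>2 - D" "qclass (Z ^ n) t = \<one>\<^bsub>class_group D\<^esub>"
    using solution_imp_qclass_one[OF xy(2,3,1)] by blast
  have dj: "Z ^ j dvd t\<^sup>2 - D" if "j \<le> n" for j
    using le_imp_power_dvd[OF that] t(1) by (rule dvd_trans)
  have Zt: "coprime Z t" using dj[of 1] ZD n coprime_root_iff_coprime_D by simp
  define g where "g = qclass Z t"
  have gc: "g \<in> carrier (class_group D)" using Z by (simp add: g_def)
  have pow: "qclass (Z ^ j) t = g [^]\<^bsub>class_group D\<^esub> j" if "j \<le> n" for j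
    unfolding g_def using dj[OF that] Zt by (rule qclass_power)
  have dvd: "cg.ord g dvd n" using t(2) pow[of n] cg.pow_eq_id[OF gc] by simp
  have "cg.ord g = n"
  proof (rule ccontr)
    assume ne: "cg.ord g \<noteq> n"
    \<comment> \<open>\<open>ord\<close> has the value 0 for elements of infinite order; dividing
      \<open>n > 0\<close> rules this out.\<close>
    have "cg.ord g \<noteq> 0" using dvd n by (intro notI) simp
    then have j: "1 \<le> cg.ord g" "cg.ord g \<le> n" using dvd_imp_le[OF dvd] n by simp_all
    have "qclass (Z ^ cg.ord g) t = \<one>\<^bsub>class_group D\<^esub>"
      using pow[OF j(2)] cg.pow_ord_eq_1[OF gc] by simp
    then show False
      using qclass_one_imp_solution[OF dj[OF j(2)]] none j(1) dvd ne by blast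
  qed
  then show ?thesis using gc by blast
qed

text \<open>\<open>Z\<close> has exact order \<open>n\<close> for every choice of the square root of \<open>D\<close> modulo powers of \<open>Z\<close>, so
  that no primitive ideal of norm \<open>Z ^ j\<close> is principal unless \<open>n\<close> divides \<open>j\<close>.\<close>
definition uniform_order :: "nat \<Rightarrow> 'a poly \<Rightarrow> bool" where
  "uniform_order n Z \<longleftrightarrow> Z \<noteq> 0 \<and> coprime Z D \<and>
    (\<forall>s j r. Z ^ j dvd s\<^sup>2 - D \<longrightarrow>
      (qclass (Z ^ j) s [^]\<^bsub>class_group D\<^esub> r = \<one>\<^bsub>class_group D\<^esub> \<longleftrightarrow> n dvd j * r))"

text \<open>Modulo the prime \<open>p\<close> the only roots of \<open>D\<close> are
  \<open>b\<close> and \<open>- b\<close>, with mutually inverse classes of equal order. The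
  exponent \<open>u\<close> cuts this order \<open>u * n\<close> down to \<open>n\<close>, whichever
  root \<open>s\<close> reduces to.\<close>

lemma uniform_order_prime_power:
  fixes r :: nat
  assumes p: "Factorial_Ring.irreducible p" and d: "p dvd b\<^sup>2 - D" and cop: "coprime p b"
    and n: "n dvd cg.ord (qclass p b)"
  shows "uniform_order n (p ^ (cg.ord (qclass p b) div n))"
proof -
  define h where "h = qclass p b"
  define u where "u = cg.ord h div n"
  have p0: "p \<noteq> 0" by (rule dvd_square_minus_D_neq_0[OF d])
  have hc: "h \<in> carrier (class_group D)" using p0 by (simp add: h_def)
  have o: "cg.ord h = u * n" using n by (simp add: u_def h_def)
  have "cg.ord h > 0" using cg.ord_ge_1[OF finite_class_group hc] by simp
  then have u0: "u > 0" using o by (cases u) auto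
  have cD: "coprime p D" using coprime_root_iff_coprime_D[OF d] cop by blast
  have "qclass ((p ^ u) ^ j) s [^]\<^bsub>class_group D\<^esub> r = \<one>\<^bsub>class_group D\<^esub> \<longleftrightarrow> n dvd j * r"
    if dj: "(p ^ u) ^ j dvd s\<^sup>2 - D" for s j and r :: nat
  proof (cases "j = 0")
    \<comment> \<open>\<open>Z ^ 0 = 1\<close> says nothing about \<open>s\<close> modulo
      \<open>p\<close>, but its class is trivial and \<open>n\<close> divides 0.\<close>
    case True
    then show ?thesis by (simp add: qclass_unit)
  next
    case False
    then have "u * j > 0" using u0 by simp
    have dj': "p ^ (u * j) dvd s\<^sup>2 - D" using dj by (simp add: power_mult)
    have ps: "p dvd s\<^sup>2 - D"
      using dvd_trans[OF dvd_power[of "u * j" p] dj'] \<open>u * j > 0\<close> by blast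
    then have "p dvd (s\<^sup>2 - D) - (b\<^sup>2 - D)" using d by (rule dvd_diff)
    moreover have "(s\<^sup>2 - D) - (b\<^sup>2 - D) = (s - b) * (s - (- b))"
      by (simp add: algebra_simps power2_eq_square)
    ultimately have "p dvd s - b \<or> p dvd s - (- b)" using euclid_prime_dvd_mult p by metis
    then have "qclass p s = h \<or> qclass p s = inv\<^bsub>class_group D\<^esub> h"
      using qclass_cong qclass_uminus[OF d cop] unfolding h_def by metis
    then have os: "cg.ord (qclass p s) = u * n" using o hc cg.ord_inv by metis
    have sc: "qclass p s \<in> carrier (class_group D)" using p0 by simp
    have "coprime p s" using coprime_root_iff_coprime_D[OF ps] cD by blast
    then have "qclass ((p ^ u) ^ j) s = qclass p s [^]\<^bsub>class_group D\<^esub> (u * j)"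
      using qclass_power[OF dj'] by (simp add: power_mult)
    then have "qclass ((p ^ u) ^ j) s [^]\<^bsub>class_group D\<^esub> r = qclass p s [^]\<^bsub>class_group D\<^esub> (u * j * r)"
      using sc by (simp add: cg.nat_pow_pow)
    then have "qclass ((p ^ u) ^ j) s [^]\<^bsub>class_group D\<^esub> r = \<one>\<^bsub>class_group D\<^esub> \<longleftrightarrow> u * n dvd u * j * r"
      using cg.pow_eq_id[OF sc] os by simp
    also have "\<dots> \<longleftrightarrow> n dvd j * r" using u0 by (simp add: mult.assoc)
    finally show ?thesis .
  qed
  moreover have "coprime (p ^ u) D" using cD by (rule euclid_coprime_power)
  ultimately show ?thesis using p0 unfolding uniform_order_def u_def h_def by simp
qed

text \<open>The same root \<open>s\<close> serves \<open>Z1 ^ j\<close> and \<open>Z2 ^ j\<close>,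
  so the class of the product is a product of classes whose orders are controlled by the coprime
  numbers \<open>n1\<close> and \<open>n2\<close>.\<close>

lemma uniform_order_mult:
  assumes 1: "uniform_order n1 Z1" and 2: "uniform_order n2 Z2"
    and Z: "coprime Z1 Z2" and n: "coprime n1 n2"
  shows "uniform_order (n1 * n2) (Z1 * Z2)"
  unfolding uniform_order_def
proof (intro conjI allI impI)
  show "Z1 * Z2 \<noteq> 0" using 1 2 by (simp add: uniform_order_def)
  show cop: "coprime (Z1 * Z2) D"
    using 1 2 unfolding uniform_order_def by (intro euclid_coprime_mult) auto
  fix s j and r :: nat
  assume "(Z1 * Z2) ^ j dvd s\<^sup>2 - D"
  then have d: "Z1 ^ j * Z2 ^ j dvd s\<^sup>2 - D" by (simp add: power_mult_distrib)
  have d1: "Z1 ^ j dvd s\<^sup>2 - D" using d by (rule dvd_mult_left)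
  have d2: "Z2 ^ j dvd s\<^sup>2 - D" using d by (rule dvd_mult_right)
  define x1 where "x1 = qclass (Z1 ^ j) s"
  define x2 where "x2 = qclass (Z2 ^ j) s"
  have c: "x1 \<in> carrier (class_group D)" "x2 \<in> carrier (class_group D)"
    using 1 2 by (simp_all add: uniform_order_def x1_def x2_def)
  have i1: "x1 [^]\<^bsub>class_group D\<^esub> r = \<one>\<^bsub>class_group D\<^esub> \<longleftrightarrow> n1 dvd j * r" for r :: nat
    using 1 d1 by (simp add: uniform_order_def x1_def)
  have i2: "x2 [^]\<^bsub>class_group D\<^esub> r = \<one>\<^bsub>class_group D\<^esub> \<longleftrightarrow> n2 dvd j * r" for r :: nat
    using 2 d2 by (simp add: uniform_order_def x2_def)
  have "coprime (Z1 ^ j) D" using 1 unfolding uniform_order_def by (blast intro: euclid_coprime_power)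
  then have "coprime (Z1 ^ j) s" using coprime_root_iff_coprime_D[OF d1] by blast
  then have q: "qclass ((Z1 * Z2) ^ j) s = x1 \<otimes>\<^bsub>class_group D\<^esub> x2"
    unfolding x1_def x2_def power_mult_distrib using d by (intro qclass_mult)
  have dist: "(x1 \<otimes>\<^bsub>class_group D\<^esub> x2) [^]\<^bsub>class_group D\<^esub> r
      = x1 [^]\<^bsub>class_group D\<^esub> r \<otimes>\<^bsub>class_group D\<^esub> x2 [^]\<^bsub>class_group D\<^esub> r" for r :: nat
    using c by (simp add: cg.nat_pow_distrib)
  show "qclass ((Z1 * Z2) ^ j) s [^]\<^bsub>class_group D\<^esub> r = \<one>\<^bsub>class_group D\<^esub> \<longleftrightarrow> n1 * n2 dvd j * r"
    unfolding q
  proof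
    assume L: "(x1 \<otimes>\<^bsub>class_group D\<^esub> x2) [^]\<^bsub>class_group D\<^esub> r = \<one>\<^bsub>class_group D\<^esub>"
    have L': "(x1 \<otimes>\<^bsub>class_group D\<^esub> x2) [^]\<^bsub>class_group D\<^esub> (r * k) = \<one>\<^bsub>class_group D\<^esub>" for k
      using L c by (simp flip: cg.nat_pow_pow)
    \<comment> \<open>Raising to the power \<open>n2\<close> removes the second factor, and
      coprimality cancels \<open>n2\<close> again; the roles are exchanged afterwards.\<close>
    have "x2 [^]\<^bsub>class_group D\<^esub> (r * n2) = \<one>\<^bsub>class_group D\<^esub>" unfolding i2 by simp
    then have "x1 [^]\<^bsub>class_group D\<^esub> (r * n2) = \<one>\<^bsub>class_group D\<^esub>"
      using L'[of n2] c unfolding dist by simp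
    then have "n1 dvd (j * r) * n2" unfolding i1 by (simp add: mult.assoc)
    then have "n1 dvd j * r" using n by (simp add: coprime_dvd_mult_left_iff)
    moreover have "x1 [^]\<^bsub>class_group D\<^esub> (r * n1) = \<one>\<^bsub>class_group D\<^esub>" unfolding i1 by simp
    then have "x2 [^]\<^bsub>class_group D\<^esub> (r * n1) = \<one>\<^bsub>class_group D\<^esub>"
      using L'[of n1] c unfolding dist by simp
    then have "n2 dvd (j * r) * n1" unfolding i2 by (simp add: mult.assoc)
    then have "n2 dvd j * r" using n by (simp add: coprime_dvd_mult_left_iff coprime_commute)
    ultimately show "n1 * n2 dvd j * r" using n by (rule divides_mult)
  next
    assume "n1 * n2 dvd j * r"
    then have "n1 dvd j * r" "n2 dvd j * r" by (rule dvd_mult_left, rule dvd_mult_right)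
    then have "x1 [^]\<^bsub>class_group D\<^esub> r = \<one>\<^bsub>class_group D\<^esub>" "x2 [^]\<^bsub>class_group D\<^esub> r = \<one>\<^bsub>class_group D\<^esub>"
      using i1 i2 by blast+
    then show "(x1 \<otimes>\<^bsub>class_group D\<^esub> x2) [^]\<^bsub>class_group D\<^esub> r = \<one>\<^bsub>class_group D\<^esub>"
      unfolding dist by simp
  qed
qed

lemma ord_mult_dvd_lcm:
  assumes "x \<in> carrier (class_group D)" "y \<in> carrier (class_group D)"
  shows "cg.ord (x \<otimes>\<^bsub>class_group D\<^esub> y) dvd lcm (cg.ord x) (cg.ord y)"
proof -
  have "x [^]\<^bsub>class_group D\<^esub> lcm (cg.ord x) (cg.ord y) = \<one>\<^bsub>class_group D\<^esub>"
    "y [^]\<^bsub>class_group D\<^esub> lcm (cg.ord x) (cg.ord y) = \<one>\<^bsub>class_group D\<^esub>"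
    using assms by (simp_all add: cg.pow_eq_id)
  then show ?thesis using assms by (simp add: cg.nat_pow_distrib flip: cg.pow_eq_id)
qed

text \<open>Induction that splits off from \<open>m\<close> the full power of one prime. The
  conclusion \<open>Z dvd m ^ k\<close> records that \<open>Z\<close> has only prime factors of
  \<open>m\<close>, which keeps the two parts coprime and later supplies roots of \<open>D\<close>
  modulo powers of \<open>Z\<close>.\<close>

lemma uniform_order_exists:
  assumes "m dvd b\<^sup>2 - D" "coprime m b" "n dvd cg.ord (qclass m b)" "n > 0"
  shows "\<exists>Z k. Z dvd m ^ k \<and> uniform_order n Z"
  using assms
proof (induction "Polynomial.degree m" arbitrary: m n rule: less_induct)
  case less
  have m0: "m \<noteq> 0" by (rule dvd_square_minus_D_neq_0[OF less.prems(1)])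
  show ?case
  proof (cases "is_unit m")
    case True
    then have "n = 1" using less.prems(3) by (simp add: qclass_unit)
    then have "uniform_order n 1" by (simp add: uniform_order_def qclass_unit)
    then show ?thesis by (metis one_dvd)
  next
    case False
    then obtain p where p: "Factorial_Ring.irreducible p" "p dvd m"
      using euclid_irreducible_factor m0 by blast
    obtain k m' where m: "m = p ^ k * m'" "coprime p m'"
      using euclid_prime_power_split[OF p(1) m0] by blast
    have pu: "\<not> is_unit p" using p(1) unfolding Factorial_Ring.irreducible_def by blast
    have k0: "k > 0"
    proof (rule ccontr)
      assume "\<not> k > 0"
      then have "p dvd m'" using p(2) m(1) by simp
      then show False using m(2) pu by (metis coprime_absorb_left)
    qed
    have p0: "p \<noteq> 0" and m'0: "m' \<noteq> 0" using m0 m(1) k0 by auto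
    have "Polynomial.degree p > 0" using pu p0 by (simp add: is_unit_iff_degree)
    then have deg: "Polynomial.degree m' < Polynomial.degree m"
      using m(1) p0 m'0 k0 by (simp add: degree_mult_eq degree_power_eq)
    have m'd: "m' dvd b\<^sup>2 - D" using less.prems(1) unfolding m(1) by (rule dvd_mult_right)
    have pkd: "p ^ k dvd b\<^sup>2 - D" using less.prems(1) unfolding m(1) by (rule dvd_mult_left)
    have m'b: "coprime m' b" using less.prems(2) m(1) by (metis coprime_dvd_left_mono dvd_triv_right)
    have pb: "coprime p b" using less.prems(2) p(2) by (rule coprime_dvd_left_mono)
    have pd: "p dvd b\<^sup>2 - D" using p(2) less.prems(1) by (rule dvd_trans)
    have hc: "qclass p b \<in> carrier (class_group D)" and gc: "qclass m' b \<in> carrier (class_group D)"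
      using p0 m'0 by simp_all
    have "qclass m b = qclass p b [^]\<^bsub>class_group D\<^esub> k \<otimes>\<^bsub>class_group D\<^esub> qclass m' b"
      using qclass_mult[of "p ^ k" m' b] less.prems(1) m(1) euclid_coprime_power[OF pb]
        qclass_power[OF pkd pb] by simp
    then have "n dvd lcm (cg.ord (qclass p b [^]\<^bsub>class_group D\<^esub> k)) (cg.ord (qclass m' b))"
      using less.prems(3) dvd_trans[OF _ ord_mult_dvd_lcm[OF cg.nat_pow_closed[OF hc] gc]] by simp
    also have "\<dots> dvd lcm (cg.ord (qclass p b)) (cg.ord (qclass m' b))"
    proof (rule lcm_mono)
      have "(qclass p b [^]\<^bsub>class_group D\<^esub> k) [^]\<^bsub>class_group D\<^esub> cg.ord (qclass p b) = \<one>\<^bsub>class_group D\<^esub>"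
        using hc by (simp add: cg.nat_pow_pow cg.pow_eq_id)
      then show "cg.ord (qclass p b [^]\<^bsub>class_group D\<^esub> k) dvd cg.ord (qclass p b)"
        using hc by (simp add: cg.pow_eq_id)
    qed simp
    finally have "n dvd lcm (cg.ord (qclass p b)) (cg.ord (qclass m' b))" .
    moreover have "cg.ord (qclass p b) > 0" "cg.ord (qclass m' b) > 0"
      using cg.ord_ge_1[OF finite_class_group] hc gc by (simp_all add: Suc_le_eq)
    \<comment> \<open>\<open>n1\<close> is realised by a power of \<open>p\<close>, and
      \<open>n2\<close>, by induction, by a divisor of a power of \<open>m'\<close>.\<close>
    ultimately obtain n1 n2 where n: "n = n1 * n2" "coprime n1 n2"
      "n1 dvd cg.ord (qclass p b)" "n2 dvd cg.ord (qclass m' b)"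
      using dvd_lcm_split less.prems(4) by blast
    have "n2 > 0" using n(1) less.prems(4) by (cases n2) auto
    from less.hyps[OF deg m'd m'b n(4) this] obtain Z2 k2
      where Z2: "Z2 dvd m' ^ k2" "uniform_order n2 Z2" by blast
    define u where "u = cg.ord (qclass p b) div n1"
    have Z1: "uniform_order n1 (p ^ u)"
      unfolding u_def by (rule uniform_order_prime_power[OF p(1) pd pb n(3)])
    have "coprime (m' ^ k2) (p ^ u)"
      using m(2) by (metis coprime_commute euclid_coprime_power)
    then have "coprime (p ^ u) Z2"
      using Z2(1) by (metis coprime_commute coprime_dvd_left_mono)
    then have "uniform_order n (p ^ u * Z2)"
      unfolding n(1) using Z1 Z2(2) n(2) by (intro uniform_order_mult)
    moreover have "p ^ u * Z2 dvd m ^ (u + k2)"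
      unfolding power_add
    proof (rule mult_dvd_mono)
      show "p ^ u dvd m ^ u" using p(2) by (rule dvd_power_same)
      have "m' ^ k2 dvd m ^ k2" using m(1) by (intro dvd_power_same) simp
      then show "Z2 dvd m ^ k2" using Z2(1) dvd_trans by blast
    qed
    ultimately show ?thesis by blast
  qed
qed

text \<open>Hensel lifting for \<open>X\<^sup>2 - D\<close>: the derivative \<open>2 t\<close> at a
  root \<open>t\<close> is invertible modulo \<open>m\<close>.\<close>

lemma hensel_square_root:
  assumes "m dvd b\<^sup>2 - D" "coprime m b"
  shows "\<exists>t. m ^ k dvd t\<^sup>2 - D"
proof (induction k)
  case (Suc k)
  then obtain t where t: "m ^ k dvd t\<^sup>2 - D" by blast
  show ?case
  proof (cases "k = 0")
    case True
    \<comment> \<open>The lifting below needs \<open>m dvd m ^ k\<close>, so the first power is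
      taken from the given root.\<close>
    then show ?thesis using assms(1) by auto
  next
    case False
    then have mk: "m dvd m ^ k" by simp
    then have mt: "m dvd t\<^sup>2 - D" using t by (rule dvd_trans)
    then have "coprime m t"
      using assms coprime_root_iff_coprime_D by blast
    then obtain r w where rw: "r * m + w * (2 * t) = 1" using coprime_bezout_two by blast
    obtain q where q: "t\<^sup>2 - D = m ^ k * q" using t by (elim dvdE)
    \<comment> \<open>Solves \<open>q + 2 t s = 0\<close> modulo \<open>m\<close>, the linear
      condition for \<open>t + s m ^ k\<close> to be a root modulo
      \<open>m ^ (k + 1)\<close>.\<close>
    define s where "s = - (w * q)"
    have "q + 2 * t * s = q * (r * m + w * (2 * t)) + 2 * t * s" by (simp add: rw)
    also have "\<dots> = m * (q * r)" by (simp add: s_def algebra_simps)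
    finally have "m dvd (q + 2 * t * s) + s * s * m ^ k" using mk by simp
    then have "m ^ k * m dvd m ^ k * ((q + 2 * t * s) + s * s * m ^ k)" by (intro mult_dvd_mono) simp_all
    also have "\<dots> = (t + s * m ^ k)\<^sup>2 - D"
      using q by (simp add: algebra_simps power2_eq_square)
    finally show ?thesis by (metis power_Suc2)
  qed
qed simp

text \<open>\<open>uniform_order\<close> speaks about all roots of \<open>D\<close> modulo powers of
  \<open>Z\<close> and asserts none. Hensel lifting provides one modulo \<open>m ^ (k * n)\<close>,
  a multiple of \<open>Z ^ n\<close>.\<close>

lemma class_of_order_imp_uniform_order:
  assumes g: "g \<in> carrier (class_group D)" "cg.ord g = n" and n: "n > 0"
  shows "\<exists>Z t. uniform_order n Z \<and> Z ^ n dvd t\<^sup>2 - D"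
proof -
  obtain m b where m: "m dvd b\<^sup>2 - D" "coprime m b" "g = qclass m b"
    using class_group_form[OF g(1)] by blast
  then obtain Z k where Z: "Z dvd m ^ k" "uniform_order n Z"
    using uniform_order_exists[OF m(1,2), of n] g(2) n by auto
  obtain t where "m ^ (k * n) dvd t\<^sup>2 - D" using hensel_square_root[OF m(1,2)] by blast
  moreover have "Z ^ n dvd m ^ (k * n)" unfolding power_mult using Z(1) by (rule dvd_power_same)
  ultimately show ?thesis using Z(2) dvd_trans by blast
qed

section \<open>The two directions of the equivalence\<close>

lemma cyclic_subgroup_iff:
  assumes n: "n \<ge> 2"
  shows "has_cyclic_subgroup_of_order (class_group D) n \<longleftrightarrow>
    (\<exists>Z :: 'a poly. Z \<notin> range (\<lambda>a. [:a:]) \<and>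
       (\<exists>c. c \<noteq> 0 \<and>
          (\<exists>x y. coprime x y \<and> x\<^sup>2 - D * y\<^sup>2 = Polynomial.smult c (Z ^ n))) \<and>
       (\<forall>c' j. c' \<noteq> 0 \<and> 1 \<le> j \<and> j dvd n \<and> j \<noteq> n \<longrightarrow>
          \<not> (\<exists>x y. coprime x y \<and> x\<^sup>2 - D * y\<^sup>2 = Polynomial.smult c' (Z ^ j))))"
    (is "?L \<longleftrightarrow> (\<exists>Z. ?P Z)")
proof
  assume ?L
  then obtain g where "g \<in> carrier (class_group D)" "cg.ord g = n"
    using cg.has_cyclic_subgroup_iff_ord by blast
  then obtain Z t where Z: "uniform_order n Z" and t: "Z ^ n dvd t\<^sup>2 - D"
    using class_of_order_imp_uniform_order n by fastforce
  have uo: "qclass (Z ^ j) s [^]\<^bsub>class_group D\<^esub> (1::nat) = \<one>\<^bsub>class_group D\<^esub> \<longleftrightarrow> n dvd j * 1"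
    if "Z ^ j dvd s\<^sup>2 - D" for s j
    using Z that unfolding uniform_order_def by blast
  have Z0: "Z \<noteq> 0" using Z by (simp add: uniform_order_def)
  have uo': "qclass (Z ^ j) s = \<one>\<^bsub>class_group D\<^esub> \<longleftrightarrow> n dvd j" if "Z ^ j dvd s\<^sup>2 - D" for s j
    using uo[OF that] Z0 by simp
  have "\<not> is_unit Z"
  proof
    \<comment> \<open>A unit has trivial class already for \<open>j = 1\<close>, which would force
      \<open>n dvd 1\<close>.\<close>
    assume "is_unit Z"
    then have "Z ^ 1 dvd t\<^sup>2 - D" "qclass (Z ^ 1) t = \<one>\<^bsub>class_group D\<^esub>"
      by (simp_all add: qclass_unit unit_imp_dvd)
    then show False using uo'[of 1 t] n by simp
  qed
  then have "Z \<notin> range (\<lambda>a. [:a:])"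
    using Z0 by (auto simp: is_unit_iff_degree)
  moreover have "qclass (Z ^ n) t = \<one>\<^bsub>class_group D\<^esub>" using uo'[OF t] by simp
  then have "\<exists>c x y. c \<noteq> 0 \<and> coprime x y \<and> x\<^sup>2 - D * y\<^sup>2 = Polynomial.smult c (Z ^ n)"
    by (rule qclass_one_imp_solution[OF t])
  moreover have "x\<^sup>2 - D * y\<^sup>2 \<noteq> Polynomial.smult c' (Z ^ j)"
    if c': "c' \<noteq> 0" and j: "j dvd n" "j \<noteq> n" and xy: "coprime x y" for c' j x y
  proof
    assume "x\<^sup>2 - D * y\<^sup>2 = Polynomial.smult c' (Z ^ j)"
    \<comment> \<open>The root \<open>s\<close> comes from the assumed solution and is unrelated to
      \<open>t\<close>; the contradiction needs uniformity over all roots.\<close>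
    then obtain s where "Z ^ j dvd s\<^sup>2 - D" "qclass (Z ^ j) s = \<one>\<^bsub>class_group D\<^esub>"
      using solution_imp_qclass_one[OF xy _ c'] by blast
    then have "n dvd j" using uo' by blast
    then show False using j by (simp add: dvd_antisym)
  qed
  ultimately show "\<exists>Z. ?P Z" by blast
next
  assume "\<exists>Z. ?P Z"
  then obtain Z c x y where Z: "Z \<notin> range (\<lambda>a. [:a:])" "c \<noteq> 0" "coprime x y"
    "x\<^sup>2 - D * y\<^sup>2 = Polynomial.smult c (Z ^ n)"
    and none: "\<And>c' j x y. c' \<noteq> 0 \<Longrightarrow> 1 \<le> j \<Longrightarrow> j dvd n \<Longrightarrow> j \<noteq> n \<Longrightarrow> coprime x y \<Longrightarrow>
      x\<^sup>2 - D * y\<^sup>2 \<noteq> Polynomial.smult c' (Z ^ j)"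
    by blast
  have "Z \<noteq> 0" using Z(1) by (auto intro: range_eqI[of _ _ 0])
  then show ?L
    using solution_imp_class_of_order[OF n _ Z(2-4)] none cg.has_cyclic_subgroup_iff_ord by blast
qed

end

theorem theorem1:
  fixes D :: "'a::{finite, field} poly" and n :: nat
  assumes "odd CARD('a)"
    and "real_quadratic D"
    and "n \<ge> 2"
  shows "has_cyclic_subgroup_of_order (class_group D) n \<longleftrightarrow>
    (\<exists>Z :: 'a poly. Z \<notin> range (\<lambda>a. [:a:]) \<and>
       (\<exists>c. c \<noteq> 0 \<and>
          (\<exists>x y. coprime x y \<and> x\<^sup>2 - D * y\<^sup>2 = Polynomial.smult c (Z ^ n))) \<and>
       (\<forall>c' j. c' \<noteq> 0 \<and> 1 \<le> j \<and> j dvd n \<and> j \<noteq> n \<longrightarrow>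
          \<not> (\<exists>x y. coprime x y \<and> x\<^sup>2 - D * y\<^sup>2 = Polynomial.smult c' (Z ^ j))))"
proof -
  interpret real_quadratic_field D
    using assms by unfold_locales
  show ?thesis using assms(3) by (rule cyclic_subgroup_iff)
qed

end
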